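(* Let $D$ be a finite set, $M=\mathrm{QoI}(D)$. Type commands in the set object $\mathcal U(\mathit{Var})$ and let the labelling act only on the observation: for $\sigma:\mathit{Var}\to M_1$, a command $C$ and $W\subseteq\mathit{Var}$, the bound is $\alpha_\sigma(\mathbb J_W)$ with $\mathbb J_W=\bigotimes_{w\in W}\Delta_C(w)$. For every $\sigma:\mathit{Var}\to M_1$: (1) it is sound: $\pi_W\circ\llbracket C\rrbracket\circ\hat g:\alpha_\sigma(\mathbb J_W)\Rightarrow\mathrm{Id}$ for every $C$, $W$ and every mediator family $g$ legal for $\sigma$; (2) it is below every judgement derivable with $M$-valued environments: if $1\vdash_M\sigma\{C\}\Gamma'$ is derivable then $\alpha_\sigma(\mathbb J_W)\sqsubseteq\bigotimes_{w\in W}\Gamma'(w)$ for every $W$; (3) it agrees with $M$-valued typing, i.e. $\alpha_\sigma(\mathbb J_W)=\bigotimes_{w\in W}\mathcal A^C_M(1,\sigma)(w)$ for every $C$ and $W$, if and only if $\sigma(v)\otimes\sigma(v)=\sigma(v)$ for every $v\in\mathit{Var}$.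
   Context: Quantale of information. $D$ is finite. $\mathrm{LoI}(D)$ is the set of equivalence relations on $D$ ordered by $P\sqsubseteq Q$ iff $Q\subseteq P$, so $P\sqcup Q=P\cap Q$, the least element $\mathrm{All}$ is the total relation and the greatest, $\mathrm{Id}$, is equality. For $\mathbb P\subseteq\mathrm{LoI}(D)$, $\mathrm{mix}(\mathbb P)$ is the set of equivalence relations each of whose cells is a cell of some member of $\mathbb P$, and $\mathrm{tc}(\mathbb P)={\downarrow}\mathrm{mix}(\mathbb P)$. $\mathrm{QoI}(D)$ is the set of $\mathbb P$ with $\mathrm{tc}(\mathbb P)=\mathbb P$, ordered by inclusion (written $\sqsubseteq$), with $\bigvee_i\mathbb P_i=\mathrm{tc}(\bigcup_i\mathbb P_i)$, $\mathbb P\otimes\mathbb Q=\mathrm{tc}\{P\sqcup Q\mid P\in\mathbb P,Q\in\mathbb Q\}$, unit $1=\{\mathrm{All}\}$; it is a commutative complete quantale. For a quantale $M$, $M_1=\{m\mid 1\sqsubseteq m\}$, $m^0=1$, $m^n$ is the $n$-fold tensor power, $m^*=\bigvee_{n\ge0}m^n$; empty tensors are $1$. Language. $\mathit{Var}$ is finite; stores are maps $\mathit{Var}\to\mathit{Val}$. Commands: $\mathsf{skip}$, $x:=E$, $C_1;C_2$, $\mathsf{if}\;E\;C_1\;C_2$, $\mathsf{while}\;E\;C$, with the standard semantics $\llbracket C\rrbracket$, a partial function on stores (undefined on nontermination). Expressions (including single variables) evaluate totally, their value depends only on the variables in $\mathit{fv}(E)$, and guards are decided by a fixed two-valued test on the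 value of $E$. $\mathit{asgn}(C)$ is the set of variables assigned in $C$. $\pi_W$ restricts a store to $W$. Mediators. For a partial function $h$ on $D$ and $\mathbb P\in\mathrm{QoI}(D)$, $h:\mathbb P\Rightarrow\mathrm{Id}$ means: some $P\in\mathbb P$ satisfies $h(d)=h(d')$ whenever $d\,P\,d'$ and both are defined. A mediator family is $g=\langle g_v:D\rightharpoonup\mathit{Val}\rangle_{v\in\mathit{Var}}$ of partial functions with a common domain; $\hat g(d)$ is the store with $v$-component $g_v(d)$. $g$ is legal for $\sigma$ when $g_v:\sigma(v)\Rightarrow\mathrm{Id}$ for every $v$. Set object. $\mathcal U=\mathcal U(\mathit{Var})$ is the set of downsets of $(\mathcal P(\mathit{Var}),\subseteq)$ ordered by inclusion, with $\bigvee=\bigcup$, $\mathbb X\otimes\mathbb Y={\downarrow}\{X\cup Y\mid X\in\mathbb X,Y\in\mathbb Y\}$, $1={\downarrow}\emptyset$; generators $\hat v={\downarrow}\{v\}$. $\alpha_\sigma(\mathbb X)=\bigvee_{X\in\mathbb X}\bigotimes_{v\in X}\sigma(v)$. Typing rules (for each commutative complete quantale $M$). $\Gamma:\mathit{Var}\to M_1$, $p\in M_1$, $t_E(\Gamma)=\bigotimes_{v\in\mathit{fv}(E)}\Gamma(v)$. Derivability $p\vdash_M\Gamma\{C\}\Gamma'$ is generated by: (Skip) $p\vdash\Gamma\{\mathsf{skip}\}\Gamma$. (Assign) $p\vdash\Gamma\{x:=E\}\Gamma[x\mapsto p\otimes t_E(\Gamma)]$. (Seq) from $p\vdash\Gamma\{C_1\}\Gamma''$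 and $p\vdash\Gamma''\{C_2\}\Gamma'$ infer $p\vdash\Gamma\{C_1;C_2\}\Gamma'$. (If) with $t=t_E(\Gamma)$, from $p\otimes t\vdash\Gamma\{C_i\}\Gamma_i'$ ($i=1,2$) infer $p\vdash\Gamma\{\mathsf{if}\;E\;C_1\;C_2\}\Gamma'$ where $\Gamma'(x)=t\otimes(\Gamma_1'(x)\vee\Gamma_2'(x))$ for $x\in\mathit{asgn}(C_1)\cup\mathit{asgn}(C_2)$ and $\Gamma'(x)=\Gamma(x)$ otherwise. (While) with $t=t_E(\Gamma)$, from $p\otimes t\vdash\Gamma\{C\}\Gamma$ infer $p\vdash\Gamma\{\mathsf{while}\;E\;C\}\Gamma^\dagger$ where $\Gamma^\dagger(x)=t^*\otimes\Gamma(x)$ for $x\in\mathit{asgn}(C)$ and $\Gamma^\dagger(x)=\Gamma(x)$ otherwise. (Sub) from $p\vdash\Gamma\{C\}\Gamma_1'$, $p'\sqsubseteq p$, $\Gamma'\sqsubseteq\Gamma$, $\Gamma_1'\sqsubseteq\Gamma_2'$ infer $p'\vdash\Gamma'\{C\}\Gamma_2'$. Algorithmic system. $\mathcal A^C_M(p,\Gamma):\mathit{Var}\to M_1$ (the least derivable postcondition) is defined by recursion on $C$: $\Gamma$ for $\mathsf{skip}$; $\Gamma[x\mapsto p\otimes t_E(\Gamma)]$ for $x:=E$; $\mathcal A^{C_2}(p,\mathcal A^{C_1}(p,\Gamma))$ for $C_1;C_2$; for $\mathsf{if}\;E\;C_1\;C_2$, with $t=t_E(\Gamma)$, $\Gamma_i'=\mathcal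 A^{C_i}(p\otimes t,\Gamma)$, the environment $x\mapsto t\otimes(\Gamma_1'(x)\vee\Gamma_2'(x))$ for $x\in\mathit{asgn}(C_1)\cup\mathit{asgn}(C_2)$ and $x\mapsto\Gamma(x)$ otherwise; for $\mathsf{while}\;E\;C$, with $\Gamma^*$ the least fixed point of $\Theta\mapsto\Gamma\vee\mathcal A^C(p\otimes t_E(\Theta),\Theta)$ and $t=t_E(\Gamma^* )$, the environment $x\mapsto t^*\otimes\Gamma^*(x)$ for $x\in\mathit{asgn}(C)$ and $x\mapsto\Gamma^*(x)$ otherwise. $\Delta_C=\mathcal A^C_{\mathcal U}(1,\Delta_0)$ with $\Delta_0(v)=\hat v$. *)

theory Defs
  imports "HOL-Library.FuncSet"
begin

class comm_quantale = complete_lattice + comm_monoid_mult +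
  assumes mult_Sup_distrib: "x * Sup A = Sup ((\<lambda>y. x * y) ` A)"

definition M1 :: "'m::comm_quantale set" where
  "M1 = {m. 1 \<le> m}"

definition qstar :: "'m::comm_quantale \<Rightarrow> 'm" where
  "qstar m = (SUP n::nat. m ^ n)"

lemma qmult_left_mono:
  fixes x y z :: "'m::comm_quantale"
  assumes "y \<le> z"
  shows "x * y \<le> x * z"
proof -
  have "x * Sup {y, z} = Sup {x * y, x * z}"
    using mult_Sup_distrib[of x "{y, z}"] by simp
  then have "x * z = sup (x * y) (x * z)"
    using assms by (simp add: sup_absorb2)
  then show ?thesis by (metis sup_ge1)
qed

lemma qmult_mono:
  fixes w x y z :: "'m::comm_quantale"
  assumes "w \<le> x" and "y \<le> z"
  shows "w * y \<le> x * z"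
  using qmult_left_mono[OF assms(1), of y] qmult_left_mono[OF assms(2), of x]
  by (metis mult.commute order_trans)

lemma qprod_mono:
  fixes f g :: "'a \<Rightarrow> 'm::comm_quantale"
  assumes "\<And>x. x \<in> A \<Longrightarrow> f x \<le> g x"
  shows "prod f A \<le> prod g A"
  using assms by (induction A rule: infinite_finite_induct) (auto intro: qmult_mono)

lemma qpower_mono:
  fixes x y :: "'m::comm_quantale"
  shows "x \<le> y \<Longrightarrow> x ^ n \<le> y ^ n"
  by (induction n) (auto intro: qmult_mono)

lemma qstar_mono: "x \<le> y \<Longrightarrow> qstar x \<le> qstar y"
  unfolding qstar_def by (intro SUP_mono) (auto intro: qpower_mono)

text \<open>The lattice of information is ordered by reverse inclusion of relations, so the join of
  \<open>P\<close> and \<open>Q\<close> is \<open>P \<inter> Q\<close>, the least element is \<open>UNIV\<close>, and the down-closure of a set collects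
  the equivalence relations that contain some member of it. The set \<open>D\<close> is the universe of the type
  \<open>'d\<close>, and the cells of \<open>R\<close> are the members of \<open>UNIV // R\<close>.\<close>

definition LoI :: "'d rel set" where
  "LoI = {R. equiv UNIV R}"

definition mix :: "'d rel set \<Rightarrow> 'd rel set" where
  "mix \<P> = {R \<in> LoI. UNIV // R \<subseteq> (\<Union>P\<in>\<P>. UNIV // P)}"

definition tc :: "'d rel set \<Rightarrow> 'd rel set" where
  "tc \<P> = {R \<in> LoI. \<exists>Q\<in>mix \<P>. Q \<subseteq> R}"

lemma LoI_image_eq:
  assumes "P \<in> LoI" and "y \<in> P `` {x}"
  shows "P `` {y} = P `` {x}"
  using assms unfolding LoI_def by (metis Image_singleton_iff equiv_class_eq mem_Collect_eq)

lemma LoI_self: "P \<in> LoI \<Longrightarrow> x \<in> P `` {x}"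
  unfolding LoI_def equiv_def refl_on_def by blast

lemma LoI_Int: "P \<in> LoI \<Longrightarrow> Q \<in> LoI \<Longrightarrow> P \<inter> Q \<in> LoI"
  unfolding LoI_def equiv_def refl_on_def sym_def trans_def by blast

lemma LoI_UNIV: "UNIV \<in> LoI"
  unfolding LoI_def equiv_def refl_on_def sym_def trans_def by simp

lemma mix_iff:
  assumes "\<P> \<subseteq> LoI"
  shows "Q \<in> mix \<P> \<longleftrightarrow> Q \<in> LoI \<and> (\<forall>x. \<exists>P\<in>\<P>. Q `` {x} = P `` {x})"
proof
  assume Q: "Q \<in> mix \<P>"
  then have QL: "Q \<in> LoI" by (simp add: mix_def)
  have "\<exists>P\<in>\<P>. Q `` {x} = P `` {x}" for x
  proof -
    have "Q `` {x} \<in> UNIV // Q" by (simp add: quotientI)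
    then obtain P where P: "P \<in> \<P>" "Q `` {x} \<in> UNIV // P"
      using Q unfolding mix_def by blast
    then obtain y where y: "Q `` {x} = P `` {y}" by (elim quotientE)
    have "x \<in> P `` {y}" using LoI_self[OF QL, of x] unfolding y .
    moreover have "P \<in> LoI" using P assms by (simp add: subsetD)
    ultimately have "P `` {x} = P `` {y}" using LoI_image_eq by metis
    then show ?thesis using P y by (intro bexI[of _ P]) simp
  qed
  then show "Q \<in> LoI \<and> (\<forall>x. \<exists>P\<in>\<P>. Q `` {x} = P `` {x})" using QL by blast
next
  assume "Q \<in> LoI \<and> (\<forall>x. \<exists>P\<in>\<P>. Q `` {x} = P `` {x})"
  then show "Q \<in> mix \<P>"
    unfolding mix_def by (auto elim!: quotientE intro: quotientI) (metis UNIV_I quotientI)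
qed

lemma tc_subset_LoI: "tc \<P> \<subseteq> LoI"
  by (auto simp: tc_def)

lemma tc_down: "P \<in> tc \<P> \<Longrightarrow> P \<subseteq> R \<Longrightarrow> R \<in> LoI \<Longrightarrow> R \<in> tc \<P>"
  unfolding tc_def by blast

lemma tc_extensive: "\<P> \<subseteq> LoI \<Longrightarrow> \<P> \<subseteq> tc \<P>"
  unfolding tc_def using mix_iff by blast

lemma tc_glue:
  assumes P: "\<P> \<subseteq> LoI" and R: "R \<in> LoI"
    and loc: "\<And>x. \<exists>P\<in>tc \<P>. R `` {x} = P `` {x}"
  shows "R \<in> tc \<P>"
proof -
  define G where "G c Q \<longleftrightarrow> Q \<in> LoI \<and> (\<forall>y\<in>c. Q `` {y} \<subseteq> c \<and> (\<exists>P\<in>\<P>. Q `` {y} = P `` {y}))" for c Q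
  have ex: "\<exists>Q. G (R `` {x}) Q" for x
  proof -
    obtain T where T: "T \<in> tc \<P>" "R `` {x} = T `` {x}" using loc by blast
    then have TL: "T \<in> LoI" by (simp add: tc_def)
    obtain Q where Q: "Q \<in> mix \<P>" "Q \<subseteq> T" using T by (auto simp: tc_def)
    have "Q `` {y} \<subseteq> R `` {x}" if "y \<in> R `` {x}" for y
    proof -
      have "y \<in> T `` {x}" using that T(2) by simp
      then have "T `` {y} = T `` {x}" by (rule LoI_image_eq[OF TL])
      moreover have "Q `` {y} \<subseteq> T `` {y}" using Q(2) by (rule Image_mono) simp
      ultimately show ?thesis using T(2) by simp
    qed
    moreover have "Q \<in> LoI" "\<forall>y. \<exists>P\<in>\<P>. Q `` {y} = P `` {y}"
      using Q(1) mix_iff[OF P, of Q] by simp_all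
    ultimately have "G (R `` {x}) Q" by (simp add: G_def)
    then show ?thesis by (rule exI)
  qed
  define q where "q c = (SOME Q. G c Q)" for c
  have Gq: "G (R `` {x}) (q (R `` {x}))" for x
    unfolding q_def using ex by (rule someI_ex)
  have q: "q (R `` {x}) \<in> LoI"
      "y \<in> R `` {x} \<Longrightarrow> q (R `` {x}) `` {y} \<subseteq> R `` {x}"
      "y \<in> R `` {x} \<Longrightarrow> \<exists>P\<in>\<P>. q (R `` {x}) `` {y} = P `` {y}" for x y
    using Gq[of x] by (simp_all add: G_def)
  define Q where "Q = {(x, y). y \<in> q (R `` {x}) `` {x}}"
  have Qx: "Q `` {x} = q (R `` {x}) `` {x}" for x by (auto simp: Q_def)
  have QR: "Q `` {x} \<subseteq> R `` {x}" for x
    using q(2)[OF LoI_self[OF R]] Qx by simp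
  have same: "Q `` {y} = Q `` {x}" if "y \<in> Q `` {x}" for x y
  proof -
    have "y \<in> R `` {x}" using that QR by (rule subsetD[rotated])
    then have Ry: "R `` {y} = R `` {x}" by (rule LoI_image_eq[OF R])
    have "y \<in> q (R `` {x}) `` {x}" using that by (simp only: Qx)
    then have "q (R `` {x}) `` {y} = q (R `` {x}) `` {x}" by (rule LoI_image_eq[OF q(1)])
    then show ?thesis by (simp only: Qx Ry)
  qed
  have self: "x \<in> Q `` {x}" for x unfolding Qx by (rule LoI_self[OF q(1)])
  have "equiv UNIV Q"
  proof (rule equivI)
    show "refl Q" using self by (auto simp: refl_on_def)
    show "sym Q" using self same by (auto simp: sym_def)
    show "trans Q" using same by (auto simp: trans_def)
  qed auto
  moreover have "\<exists>P\<in>\<P>. Q `` {x} = P `` {x}" for x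
    using q(3)[OF LoI_self[OF R]] Qx by simp
  ultimately have "Q \<in> mix \<P>" using mix_iff[OF P] by (simp add: LoI_def)
  moreover have "Q \<subseteq> R" using QR by auto
  ultimately show ?thesis using R by (auto simp: tc_def)
qed

lemma tc_least:
  assumes "\<P> \<subseteq> \<T>" and "\<T> \<subseteq> LoI"
    and "\<And>P R. P \<in> \<T> \<Longrightarrow> P \<subseteq> R \<Longrightarrow> R \<in> LoI \<Longrightarrow> R \<in> \<T>"
    and "\<And>R. R \<in> LoI \<Longrightarrow> (\<And>x. \<exists>P\<in>\<T>. R `` {x} = P `` {x}) \<Longrightarrow> R \<in> \<T>"
  shows "tc \<P> \<subseteq> \<T>"
proof
  fix R assume "R \<in> tc \<P>"
  then obtain Q where "R \<in> LoI" "Q \<in> mix \<P>" "Q \<subseteq> R" by (auto simp: tc_def)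
  moreover have "Q \<in> \<T>"
  proof (rule assms(4))
    have "Q \<in> LoI \<and> (\<forall>x. \<exists>P\<in>\<P>. Q `` {x} = P `` {x})"
      using \<open>Q \<in> mix \<P>\<close> mix_iff[of \<P> Q] assms(1,2) by simp
    then show "Q \<in> LoI" and "\<exists>P\<in>\<T>. Q `` {x} = P `` {x}" for x
      using assms(1) by (simp, meson subsetD)
  qed
  ultimately show "R \<in> \<T>" using assms(3) by simp
qed

lemma tc_minimal:
  assumes "\<P> \<subseteq> \<T>" and "\<T> \<subseteq> LoI" and "tc \<T> = \<T>"
  shows "tc \<P> \<subseteq> \<T>"
proof (rule tc_least[OF assms(1,2)])
  show "R \<in> \<T>" if "P \<in> \<T>" "P \<subseteq> R" "R \<in> LoI" for P R
    using tc_down[of P \<T> R] that unfolding assms(3) .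
  show "R \<in> \<T>" if "R \<in> LoI" "\<And>x. \<exists>P\<in>\<T>. R `` {x} = P `` {x}" for R
    using tc_glue[of \<T> R] assms(2) that unfolding assms(3) .
qed

lemma tc_idem: "\<P> \<subseteq> LoI \<Longrightarrow> tc (tc \<P>) = tc \<P>"
proof (rule antisym)
  assume P: "\<P> \<subseteq> LoI"
  show "tc (tc \<P>) \<subseteq> tc \<P>"
  proof (rule tc_least[OF order_refl tc_subset_LoI])
    show "R \<in> tc \<P>" if "Q \<in> tc \<P>" "Q \<subseteq> R" "R \<in> LoI" for Q R
      using that by (rule tc_down)
    show "R \<in> tc \<P>" if "R \<in> LoI" "\<And>x. \<exists>Q\<in>tc \<P>. R `` {x} = Q `` {x}" for R
      using P that by (rule tc_glue)
  qed
  show "tc \<P> \<subseteq> tc (tc \<P>)" by (rule tc_extensive[OF tc_subset_LoI])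
qed

lemma tc_mono: "\<P> \<subseteq> \<Q> \<Longrightarrow> tc \<P> \<subseteq> tc \<Q>"
proof -
  assume "\<P> \<subseteq> \<Q>"
  then have "(\<Union>P\<in>\<P>. UNIV // P) \<subseteq> (\<Union>P\<in>\<Q>. UNIV // P)" by (rule UN_mono) simp
  then have "mix \<P> \<subseteq> mix \<Q>" unfolding mix_def by (auto simp: subset_iff)
  then show ?thesis unfolding tc_def by blast
qed

lemma tc_Inter:
  assumes "\<And>\<P>. \<P> \<in> \<PP> \<Longrightarrow> \<P> \<subseteq> LoI \<and> tc \<P> = \<P>"
  shows "LoI \<inter> \<Inter>\<PP> \<subseteq> LoI \<and> tc (LoI \<inter> \<Inter>\<PP>) = LoI \<inter> \<Inter>\<PP>"
proof (intro conjI antisym)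
  have "tc (LoI \<inter> \<Inter>\<PP>) \<subseteq> \<P>" if "\<P> \<in> \<PP>" for \<P>
  proof (rule tc_minimal)
    show "LoI \<inter> \<Inter>\<PP> \<subseteq> \<P>" using that by (rule le_infI2[OF Inter_lower])
  qed (use assms[OF that] in simp_all)
  then show "tc (LoI \<inter> \<Inter>\<PP>) \<subseteq> LoI \<inter> \<Inter>\<PP>"
    by (intro Int_greatest Inter_greatest tc_subset_LoI)
  show "LoI \<inter> \<Inter>\<PP> \<subseteq> tc (LoI \<inter> \<Inter>\<PP>)" by (intro tc_extensive Int_lower1)
qed (rule Int_lower1)

definition pairwise_join :: "'d rel set \<Rightarrow> 'd rel set \<Rightarrow> 'd rel set" where
  "pairwise_join \<P> \<Q> = {P \<inter> Q | P Q. P \<in> \<P> \<and> Q \<in> \<Q>}"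

lemma pairwise_join_LoI: "\<P> \<subseteq> LoI \<Longrightarrow> \<Q> \<subseteq> LoI \<Longrightarrow> pairwise_join \<P> \<Q> \<subseteq> LoI"
  unfolding pairwise_join_def using LoI_Int by blast

lemma pairwise_join_commute: "pairwise_join \<P> \<Q> = pairwise_join \<Q> \<P>"
  unfolding pairwise_join_def by blast

lemma pairwise_join_assoc:
  "pairwise_join (pairwise_join \<P> \<Q>) \<R> = pairwise_join \<P> (pairwise_join \<Q> \<R>)"
proof (rule set_eqI)
  fix S
  have "S \<in> pairwise_join (pairwise_join \<P> \<Q>) \<R> \<longleftrightarrow>
      (\<exists>P\<in>\<P>. \<exists>Q\<in>\<Q>. \<exists>R\<in>\<R>. S = P \<inter> Q \<inter> R)"
    unfolding pairwise_join_def by blast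
  moreover have "S \<in> pairwise_join \<P> (pairwise_join \<Q> \<R>) \<longleftrightarrow>
      (\<exists>P\<in>\<P>. \<exists>Q\<in>\<Q>. \<exists>R\<in>\<R>. S = P \<inter> (Q \<inter> R))"
    unfolding pairwise_join_def by blast
  ultimately show "S \<in> pairwise_join (pairwise_join \<P> \<Q>) \<R> \<longleftrightarrow>
      S \<in> pairwise_join \<P> (pairwise_join \<Q> \<R>)"
    by (simp only: Int_assoc)
qed

lemma tc_pairwise_join_left:
  assumes "\<P> \<subseteq> LoI" and "\<Q> \<subseteq> LoI"
  shows "tc (pairwise_join (tc \<P>) \<Q>) = tc (pairwise_join \<P> \<Q>)"
proof
  let ?J = "pairwise_join \<P> \<Q>"
  have J: "?J \<subseteq> LoI" using pairwise_join_LoI[OF assms] .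
  have "tc \<P> \<subseteq> {P \<in> LoI. \<forall>Q\<in>\<Q>. P \<inter> Q \<in> tc ?J}" (is "_ \<subseteq> ?T")
  proof (rule tc_least)
    show "\<P> \<subseteq> ?T"
      using assms(1) tc_extensive[OF J] unfolding pairwise_join_def by blast
    show "?T \<subseteq> LoI" by blast
    show "R \<in> ?T" if "P \<in> ?T" "P \<subseteq> R" "R \<in> LoI" for P R
    proof -
      have "R \<inter> Q \<in> tc ?J" if "Q \<in> \<Q>" for Q
      proof (rule tc_down)
        show "P \<inter> Q \<in> tc ?J" using \<open>P \<in> ?T\<close> that by simp
        show "P \<inter> Q \<subseteq> R \<inter> Q" using \<open>P \<subseteq> R\<close> by (rule Int_mono) simp
        show "R \<inter> Q \<in> LoI" using \<open>R \<in> LoI\<close> that assms(2) by (simp add: LoI_Int subsetD)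
      qed
      then show ?thesis using \<open>R \<in> LoI\<close> by simp
    qed
    show "R \<in> ?T" if R: "R \<in> LoI" and loc: "\<And>x. \<exists>P\<in>?T. R `` {x} = P `` {x}" for R
    proof -
      have "R \<inter> Q \<in> tc ?J" if Q: "Q \<in> \<Q>" for Q
      proof (rule tc_glue[OF J])
        show "R \<inter> Q \<in> LoI" using R Q assms(2) by (simp add: LoI_Int subsetD)
        show "\<exists>P\<in>tc ?J. (R \<inter> Q) `` {x} = P `` {x}" for x
        proof -
          obtain P where "P \<in> ?T" "R `` {x} = P `` {x}" using loc by blast
          then have "P \<inter> Q \<in> tc ?J" "(R \<inter> Q) `` {x} = (P \<inter> Q) `` {x}" using Q by auto
          then show ?thesis by (rule bexI[rotated])
        qed
      qed
      then show ?thesis using R by simp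
    qed
  qed
  then have "pairwise_join (tc \<P>) \<Q> \<subseteq> tc ?J" unfolding pairwise_join_def by blast
  then show "tc (pairwise_join (tc \<P>) \<Q>) \<subseteq> tc ?J"
    using tc_mono tc_idem[OF J] by metis
  show "tc ?J \<subseteq> tc (pairwise_join (tc \<P>) \<Q>)"
    using tc_extensive[OF assms(1)] by (intro tc_mono) (auto simp: pairwise_join_def)
qed

lemma tc_pairwise_join_right:
  assumes "\<P> \<subseteq> LoI" and "\<Q> \<subseteq> LoI"
  shows "tc (pairwise_join \<P> (tc \<Q>)) = tc (pairwise_join \<P> \<Q>)"
  using tc_pairwise_join_left[OF assms(2,1)] by (simp add: pairwise_join_commute)

lemma tc_pairwise_join_UN:
  assumes x: "x \<subseteq> LoI" and A: "\<And>y. y \<in> A \<Longrightarrow> y \<subseteq> LoI"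
  shows "tc (pairwise_join x (tc (\<Union>A))) = tc (\<Union>y\<in>A. tc (pairwise_join x y))"
proof -
  have AL: "\<Union>A \<subseteq> LoI" using A by (rule Union_least)
  have J: "pairwise_join x (\<Union>A) = (\<Union>y\<in>A. pairwise_join x y)"
    unfolding pairwise_join_def by blast
  have 1: "pairwise_join x y \<subseteq> tc (pairwise_join x y)" if "y \<in> A" for y
    by (rule tc_extensive[OF pairwise_join_LoI[OF x A[OF that]]])
  have "tc (pairwise_join x (\<Union>A)) \<subseteq> tc (\<Union>y\<in>A. tc (pairwise_join x y))"
    unfolding J by (intro tc_mono UN_mono order_refl 1)
  moreover have "tc (\<Union>y\<in>A. tc (pairwise_join x y)) \<subseteq> tc (pairwise_join x (\<Union>A))"
  proof (rule tc_minimal)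
    show "(\<Union>y\<in>A. tc (pairwise_join x y)) \<subseteq> tc (pairwise_join x (\<Union>A))"
      unfolding J by (intro UN_least tc_mono UN_upper)
    show "tc (tc (pairwise_join x (\<Union>A))) = tc (pairwise_join x (\<Union>A))"
      by (rule tc_idem[OF pairwise_join_LoI[OF x AL]])
  qed (rule tc_subset_LoI)
  ultimately show ?thesis
    using tc_pairwise_join_right[OF x AL] by simp
qed

lemma tc_All: "tc {UNIV} = {UNIV :: 'd rel}"
proof -
  have "Q = UNIV" if "Q \<in> mix {UNIV :: 'd rel}" for Q
    using that by (subst (asm) mix_iff) (auto simp: LoI_UNIV)
  then show ?thesis
    using LoI_UNIV tc_extensive[of "{UNIV}"] unfolding tc_def by blast
qed

typedef 'd qoi = "{\<P> :: 'd rel set. \<P> \<subseteq> LoI \<and> tc \<P> = \<P>}"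
  morphisms qoi_rels Abs_qoi
  using tc_All LoI_UNIV by blast

setup_lifting type_definition_qoi

instantiation qoi :: (type) comm_quantale
begin

lift_definition less_eq_qoi :: "'a qoi \<Rightarrow> 'a qoi \<Rightarrow> bool" is "(\<subseteq>)" .
lift_definition less_qoi :: "'a qoi \<Rightarrow> 'a qoi \<Rightarrow> bool" is "(\<subset>)" .

lift_definition Sup_qoi :: "'a qoi set \<Rightarrow> 'a qoi" is "\<lambda>\<PP>. tc (\<Union>\<PP>)"
  by (intro conjI tc_subset_LoI tc_idem Union_least) simp

lift_definition Inf_qoi :: "'a qoi set \<Rightarrow> 'a qoi" is "\<lambda>\<PP>. LoI \<inter> \<Inter>\<PP>"
  by (rule tc_Inter) simp

lift_definition sup_qoi :: "'a qoi \<Rightarrow> 'a qoi \<Rightarrow> 'a qoi" is "\<lambda>\<P> \<Q>. tc (\<P> \<union> \<Q>)"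
  by (simp add: tc_idem tc_subset_LoI)

lift_definition inf_qoi :: "'a qoi \<Rightarrow> 'a qoi \<Rightarrow> 'a qoi" is "(\<inter>)"
proof -
  fix \<P> \<Q> :: "'a rel set"
  assume A: "\<P> \<subseteq> LoI \<and> tc \<P> = \<P>" "\<Q> \<subseteq> LoI \<and> tc \<Q> = \<Q>"
  then have "LoI \<inter> \<Inter>{\<P>, \<Q>} = \<P> \<inter> \<Q>" by auto
  moreover have "\<R> \<subseteq> LoI \<and> tc \<R> = \<R>" if "\<R> \<in> {\<P>, \<Q>}" for \<R>
    using that A by auto
  ultimately show "\<P> \<inter> \<Q> \<subseteq> LoI \<and> tc (\<P> \<inter> \<Q>) = \<P> \<inter> \<Q>"
    using tc_Inter[of "{\<P>, \<Q>}"] by simp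
qed

lift_definition bot_qoi :: "'a qoi" is "tc {}"
  by (simp add: tc_idem tc_subset_LoI)

lift_definition top_qoi :: "'a qoi" is LoI
  by (simp add: antisym tc_extensive tc_subset_LoI)

lift_definition one_qoi :: "'a qoi" is "{UNIV}"
  using tc_All LoI_UNIV by blast

lift_definition times_qoi :: "'a qoi \<Rightarrow> 'a qoi \<Rightarrow> 'a qoi" is "\<lambda>\<P> \<Q>. tc {P \<inter> Q | P Q. P \<in> \<P> \<and> Q \<in> \<Q>}"
  by (fold pairwise_join_def) (simp add: tc_idem tc_subset_LoI pairwise_join_LoI)

instance
proof
  fix x y z :: "'a qoi" and A :: "'a qoi set"
  show "(x < y) = (x \<le> y \<and> \<not> y \<le> x)" by transfer (rule less_le_not_le)
  show "x \<le> x" by transfer (rule order_refl)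
  show "x \<le> z" if "x \<le> y" "y \<le> z" using that by transfer (rule order_trans)
  show "x = y" if "x \<le> y" "y \<le> x" using that by transfer (rule antisym)
  show "inf x y \<le> x" by transfer (rule Int_lower1)
  show "inf x y \<le> y" by transfer (rule Int_lower2)
  show "x \<le> inf y z" if "x \<le> y" "x \<le> z" using that by transfer (rule Int_greatest)
  show "x \<le> sup x y"
    by transfer (rule order_trans[OF Un_upper1 tc_extensive], simp)
  show "y \<le> sup x y"
    by transfer (rule order_trans[OF Un_upper2 tc_extensive], simp)
  show "sup y z \<le> x" if "y \<le> x" "z \<le> x"
    using that by transfer (rule tc_minimal, simp_all)
  show "Inf A \<le> x" if "x \<in> A" using that by transfer (rule le_infI2, rule Inter_lower)
  show "z \<le> Inf A" if "\<And>x. x \<in> A \<Longrightarrow> z \<le> x"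
    using that by transfer (simp add: le_Inf_iff)
  show "x \<le> Sup A" if "x \<in> A"
    using that by transfer (rule order_trans[OF Union_upper tc_extensive], simp_all add: Sup_le_iff)
  show "Sup A \<le> z" if "\<And>x. x \<in> A \<Longrightarrow> x \<le> z"
    using that by transfer (rule tc_minimal, simp_all add: Sup_le_iff)
  show "Inf {} = (top :: 'a qoi)" by transfer simp
  show "Sup {} = (bot :: 'a qoi)" by transfer simp
  show "x * y * z = x * (y * z)"
  proof (transfer, fold pairwise_join_def)
    fix x y z :: "'a rel set"
    assume A: "x \<subseteq> LoI \<and> tc x = x" "y \<subseteq> LoI \<and> tc y = y" "z \<subseteq> LoI \<and> tc z = z"
    then show "tc (pairwise_join (tc (pairwise_join x y)) z) =
        tc (pairwise_join x (tc (pairwise_join y z)))"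
      by (simp add: pairwise_join_assoc tc_pairwise_join_left tc_pairwise_join_right pairwise_join_LoI)
  qed
  show "x * y = y * x"
    by (transfer, fold pairwise_join_def) (simp add: pairwise_join_commute)
  show "1 * x = x"
    by transfer simp
  show "x * Sup A = Sup ((\<lambda>y. x * y) ` A)"
    by (transfer, fold pairwise_join_def) (rule tc_pairwise_join_UN, simp_all)
qed

end

text \<open>This is the down-closure of the set of all unions \<open>X \<union> Y\<close>.\<close>

definition union_down :: "'v set set \<Rightarrow> 'v set set \<Rightarrow> 'v set set" where
  "union_down \<X> \<Y> = {Z. \<exists>X\<in>\<X>. \<exists>Y\<in>\<Y>. Z \<subseteq> X \<union> Y}"

lemma union_down_assoc3:
  "S \<in> union_down (union_down \<X> \<Y>) \<Z> \<longleftrightarrow> (\<exists>X\<in>\<X>. \<exists>Y\<in>\<Y>. \<exists>Z\<in>\<Z>. S \<subseteq> X \<union> Y \<union> Z)"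
proof
  assume "S \<in> union_down (union_down \<X> \<Y>) \<Z>"
  then obtain V X Y Z where "X \<in> \<X>" "Y \<in> \<Y>" "Z \<in> \<Z>" "V \<subseteq> X \<union> Y" "S \<subseteq> V \<union> Z"
    unfolding union_down_def by auto
  moreover from this have "S \<subseteq> X \<union> Y \<union> Z" by (meson Un_mono order_refl order_trans)
  ultimately show "\<exists>X\<in>\<X>. \<exists>Y\<in>\<Y>. \<exists>Z\<in>\<Z>. S \<subseteq> X \<union> Y \<union> Z" by (intro bexI)
next
  assume "\<exists>X\<in>\<X>. \<exists>Y\<in>\<Y>. \<exists>Z\<in>\<Z>. S \<subseteq> X \<union> Y \<union> Z"
  then obtain X Y Z where X: "X \<in> \<X>" "Y \<in> \<Y>" and Z: "Z \<in> \<Z>" "S \<subseteq> (X \<union> Y) \<union> Z"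
    by (elim bexE)
  have "X \<union> Y \<in> union_down \<X> \<Y>"
    unfolding union_down_def using X by (intro CollectI bexI[of _ X] bexI[of _ Y] order_refl)
  then show "S \<in> union_down (union_down \<X> \<Y>) \<Z>"
    unfolding union_down_def[of "union_down \<X> \<Y>"] using Z by (intro CollectI bexI[of _ "X \<union> Y"] bexI[of _ Z])
qed

lemma union_down_commute: "union_down \<X> \<Y> = union_down \<Y> \<X>"
  unfolding union_down_def by (subst Un_commute) blast

lemma union_down_assoc:
  "union_down (union_down \<X> \<Y>) \<Z> = union_down \<X> (union_down \<Y> \<Z>)"
proof (rule set_eqI)
  fix S
  have "S \<in> union_down \<X> (union_down \<Y> \<Z>) \<longleftrightarrow> S \<in> union_down (union_down \<Y> \<Z>) \<X>"
    by (simp only: union_down_commute)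
  also have "\<dots> \<longleftrightarrow> (\<exists>Y\<in>\<Y>. \<exists>Z\<in>\<Z>. \<exists>X\<in>\<X>. S \<subseteq> X \<union> Y \<union> Z)"
    unfolding union_down_assoc3 by (simp only: Un_ac)
  finally show "S \<in> union_down (union_down \<X> \<Y>) \<Z> \<longleftrightarrow> S \<in> union_down \<X> (union_down \<Y> \<Z>)"
    unfolding union_down_assoc3 by blast
qed

lemma union_down_one: "\<forall>X\<in>\<X>. \<forall>Y\<subseteq>X. Y \<in> \<X> \<Longrightarrow> union_down (Pow {}) \<X> = \<X>"
  unfolding union_down_def by auto

lemma union_down_UN: "union_down \<X> (\<Union>A) = \<Union>(union_down \<X> ` A)"
  unfolding union_down_def by blast

typedef 'v setobj = "{\<X> :: 'v set set. \<forall>X\<in>\<X>. \<forall>Y\<subseteq>X. Y \<in> \<X>}"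
  morphisms setobj_sets Abs_setobj
  by blast

setup_lifting type_definition_setobj

instantiation setobj :: (type) comm_quantale
begin

lift_definition less_eq_setobj :: "'a setobj \<Rightarrow> 'a setobj \<Rightarrow> bool" is "(\<subseteq>)" .
lift_definition less_setobj :: "'a setobj \<Rightarrow> 'a setobj \<Rightarrow> bool" is "(\<subset>)" .
lift_definition Sup_setobj :: "'a setobj set \<Rightarrow> 'a setobj" is "\<Union>" by blast
lift_definition Inf_setobj :: "'a setobj set \<Rightarrow> 'a setobj" is "\<Inter>" by blast
lift_definition sup_setobj :: "'a setobj \<Rightarrow> 'a setobj \<Rightarrow> 'a setobj" is "(\<union>)" by blast
lift_definition inf_setobj :: "'a setobj \<Rightarrow> 'a setobj \<Rightarrow> 'a setobj" is "(\<inter>)" by blast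
lift_definition bot_setobj :: "'a setobj" is "{}" by blast
lift_definition top_setobj :: "'a setobj" is UNIV by blast
lift_definition one_setobj :: "'a setobj" is "Pow {}" by blast
lift_definition times_setobj :: "'a setobj \<Rightarrow> 'a setobj \<Rightarrow> 'a setobj"
  is union_down by (simp add: union_down_def) (meson order_trans)

instance
proof
  fix x y z :: "'a setobj" and A :: "'a setobj set"
  show "(x < y) = (x \<le> y \<and> \<not> y \<le> x)" by transfer (rule less_le_not_le)
  show "x \<le> x" by transfer (rule order_refl)
  show "x \<le> z" if "x \<le> y" "y \<le> z" using that by transfer (rule order_trans)
  show "x = y" if "x \<le> y" "y \<le> x" using that by transfer (rule antisym)
  show "inf x y \<le> x" by transfer (rule Int_lower1)
  show "inf x y \<le> y" by transfer (rule Int_lower2)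
  show "x \<le> inf y z" if "x \<le> y" "x \<le> z" using that by transfer (rule Int_greatest)
  show "x \<le> sup x y" by transfer (rule Un_upper1)
  show "y \<le> sup x y" by transfer (rule Un_upper2)
  show "sup y z \<le> x" if "y \<le> x" "z \<le> x" using that by transfer (rule Un_least)
  show "Inf A \<le> x" if "x \<in> A" using that by transfer (rule Inter_lower)
  show "z \<le> Inf A" if "\<And>x. x \<in> A \<Longrightarrow> z \<le> x"
    using that by transfer (simp add: le_Inf_iff)
  show "x \<le> Sup A" if "x \<in> A" using that by transfer (rule Union_upper)
  show "Sup A \<le> z" if "\<And>x. x \<in> A \<Longrightarrow> x \<le> z"
    using that by transfer (simp add: Sup_le_iff)
  show "Inf {} = (top :: 'a setobj)" by transfer simp
  show "Sup {} = (bot :: 'a setobj)" by transfer simp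
  show "x * y * z = x * (y * z)"
    by transfer (rule union_down_assoc)
  show "x * y = y * x" by transfer (rule union_down_commute)
  show "1 * x = x" by transfer (rule union_down_one)
  show "x * Sup A = Sup ((\<lambda>y. x * y) ` A)" by transfer (rule union_down_UN)
qed

end

lift_definition gen :: "'v \<Rightarrow> 'v setobj" is "\<lambda>v. Pow {v}" by blast

definition alpha :: "('v::finite \<Rightarrow> 'm::comm_quantale) \<Rightarrow> 'v setobj \<Rightarrow> 'm" where
  "alpha \<sigma> \<X> = (SUP X\<in>setobj_sets \<X>. \<Prod>v\<in>X. \<sigma> v)"

text \<open>The expression language is a parameter: a type \<open>'e\<close> of expressions with free variables,
  a total evaluation function that depends only on the free variables, and an embedding of the
  variables. Guards are decided by an arbitrary test on values.\<close>

locale expr_lang =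
  fixes fv :: "'e \<Rightarrow> 'v set"
    and eval :: "'e \<Rightarrow> ('v \<Rightarrow> 'val) \<Rightarrow> 'val"
    and var :: "'v \<Rightarrow> 'e"
  assumes fv_var: "fv (var x) = {x}"
    and eval_var: "eval (var x) s = s x"
    and eval_cong: "(\<And>v. v \<in> fv E \<Longrightarrow> s v = s' v) \<Longrightarrow> eval E s = eval E s'"

datatype ('v, 'e) com =
    Skip
  | Assign 'v 'e
  | Seq "('v, 'e) com" "('v, 'e) com"
  | If 'e "('v, 'e) com" "('v, 'e) com"
  | While 'e "('v, 'e) com"

primrec asgn :: "('v, 'e) com \<Rightarrow> 'v set" where
  "asgn Skip = {}"
| "asgn (Assign x E) = {x}"
| "asgn (Seq C1 C2) = asgn C1 \<union> asgn C2"
| "asgn (If E C1 C2) = asgn C1 \<union> asgn C2"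
| "asgn (While E C) = asgn C"

text \<open>Partial functions are option-valued; \<open>None\<close> is nontermination.\<close>

partial_function (option) while_sem :: "('s \<Rightarrow> bool) \<Rightarrow> ('s \<Rightarrow> 's option) \<Rightarrow> 's \<Rightarrow> 's option" where
  "while_sem b f s = (if b s then Option.bind (f s) (while_sem b f) else Some s)"

primrec sem :: "('e \<Rightarrow> ('v \<Rightarrow> 'val) \<Rightarrow> 'val) \<Rightarrow> ('val \<Rightarrow> bool) \<Rightarrow> ('v, 'e) com \<Rightarrow>
    ('v \<Rightarrow> 'val) \<Rightarrow> ('v \<Rightarrow> 'val) option" where
  "sem eval test Skip = Some"
| "sem eval test (Assign x E) = (\<lambda>s. Some (s(x := eval E s)))"
| "sem eval test (Seq C1 C2) = sem eval test C2 \<circ>\<^sub>m sem eval test C1"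
| "sem eval test (If E C1 C2) =
    (\<lambda>s. if test (eval E s) then sem eval test C1 s else sem eval test C2 s)"
| "sem eval test (While E C) = while_sem (\<lambda>s. test (eval E s)) (sem eval test C)"

text \<open>The relation \<open>h : \<P> \<Rightarrow> Id\<close>: only pairs at which \<open>h\<close> is defined on both sides are constrained.\<close>

definition factors_Id :: "('d \<Rightarrow> 'b option) \<Rightarrow> 'd qoi \<Rightarrow> bool" where
  "factors_Id h \<P> \<longleftrightarrow>
    (\<exists>P\<in>qoi_rels \<P>. \<forall>d d'. (d, d') \<in> P \<longrightarrow> d \<in> dom h \<longrightarrow> d' \<in> dom h \<longrightarrow> h d = h d')"

definition mediator_family :: "('v \<Rightarrow> 'd \<Rightarrow> 'val option) \<Rightarrow> bool" where
  "mediator_family g \<longleftrightarrow> (\<forall>v w. dom (g v) = dom (g w))"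

definition store_of :: "('v \<Rightarrow> 'd \<Rightarrow> 'val option) \<Rightarrow> 'd \<Rightarrow> ('v \<Rightarrow> 'val) option" where
  "store_of g d = (if \<forall>v. d \<in> dom (g v) then Some (\<lambda>v. the (g v d)) else None)"

definition legal :: "('v \<Rightarrow> 'd \<Rightarrow> 'val option) \<Rightarrow> ('v \<Rightarrow> 'd qoi) \<Rightarrow> bool" where
  "legal g \<sigma> \<longleftrightarrow> (\<forall>v. factors_Id (g v) (\<sigma> v))"

definition tE :: "('e \<Rightarrow> 'v::finite set) \<Rightarrow> 'e \<Rightarrow> ('v \<Rightarrow> 'm::comm_quantale) \<Rightarrow> 'm" where
  "tE fv E \<Gamma> = (\<Prod>v\<in>fv E. \<Gamma> v)"

definition if_env :: "'v set \<Rightarrow> 'm::comm_quantale \<Rightarrow> ('v \<Rightarrow> 'm) \<Rightarrow> ('v \<Rightarrow> 'm) \<Rightarrow> ('v \<Rightarrow> 'm) \<Rightarrow> 'v \<Rightarrow> 'm" where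
  "if_env A t \<Gamma> \<Gamma>1 \<Gamma>2 = (\<lambda>x. if x \<in> A then t * sup (\<Gamma>1 x) (\<Gamma>2 x) else \<Gamma> x)"

definition while_env :: "'v set \<Rightarrow> 'm::comm_quantale \<Rightarrow> ('v \<Rightarrow> 'm) \<Rightarrow> 'v \<Rightarrow> 'm" where
  "while_env A t \<Gamma> = (\<lambda>x. if x \<in> A then qstar t * \<Gamma> x else \<Gamma> x)"

text \<open>Program counters and environments range over \<open>M1\<close>. The side conditions below are those
  that are not inherited from a premise.\<close>

inductive typed :: "('e \<Rightarrow> 'v::finite set) \<Rightarrow> 'm::comm_quantale \<Rightarrow> ('v \<Rightarrow> 'm) \<Rightarrow>
    ('v, 'e) com \<Rightarrow> ('v \<Rightarrow> 'm) \<Rightarrow> bool"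
  for fv where
  Skip: "p \<in> M1 \<Longrightarrow> range \<Gamma> \<subseteq> M1 \<Longrightarrow> typed fv p \<Gamma> Skip \<Gamma>"
| Assign: "p \<in> M1 \<Longrightarrow> range \<Gamma> \<subseteq> M1 \<Longrightarrow>
    typed fv p \<Gamma> (Assign x E) (\<Gamma>(x := p * tE fv E \<Gamma>))"
| Seq: "typed fv p \<Gamma> C1 \<Gamma>'' \<Longrightarrow> typed fv p \<Gamma>'' C2 \<Gamma>' \<Longrightarrow> typed fv p \<Gamma> (Seq C1 C2) \<Gamma>'"
| If: "p \<in> M1 \<Longrightarrow> t = tE fv E \<Gamma> \<Longrightarrow>
    typed fv (p * t) \<Gamma> C1 \<Gamma>1 \<Longrightarrow> typed fv (p * t) \<Gamma> C2 \<Gamma>2 \<Longrightarrow>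
    typed fv p \<Gamma> (If E C1 C2) (if_env (asgn C1 \<union> asgn C2) t \<Gamma> \<Gamma>1 \<Gamma>2)"
| While: "p \<in> M1 \<Longrightarrow> t = tE fv E \<Gamma> \<Longrightarrow> typed fv (p * t) \<Gamma> C \<Gamma> \<Longrightarrow>
    typed fv p \<Gamma> (While E C) (while_env (asgn C) t \<Gamma>)"
| Sub: "p' \<in> M1 \<Longrightarrow> range \<Gamma>' \<subseteq> M1 \<Longrightarrow>
    typed fv p \<Gamma> C \<Gamma>1 \<Longrightarrow> p' \<le> p \<Longrightarrow> \<Gamma>' \<le> \<Gamma> \<Longrightarrow> \<Gamma>1 \<le> \<Gamma>2 \<Longrightarrow> typed fv p' \<Gamma>' C \<Gamma>2"

text \<open>The step function is monotone (\<open>mono_alg_step\<close> below), so \<open>lfp\<close> is its least fixed point.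
  It is taken over all environments. For \<open>\<Gamma>\<close> with values in \<open>M1\<close> this
  is the least fixed point among the \<open>M1\<close>-valued ones, since every fixed point is above \<open>\<Gamma>\<close>.\<close>

primrec alg :: "('e \<Rightarrow> 'v::finite set) \<Rightarrow> ('v, 'e) com \<Rightarrow> 'm::comm_quantale \<Rightarrow> ('v \<Rightarrow> 'm) \<Rightarrow> 'v \<Rightarrow> 'm" where
  "alg fv Skip = (\<lambda>p \<Gamma>. \<Gamma>)"
| "alg fv (Assign x E) = (\<lambda>p \<Gamma>. \<Gamma>(x := p * tE fv E \<Gamma>))"
| "alg fv (Seq C1 C2) = (\<lambda>p \<Gamma>. alg fv C2 p (alg fv C1 p \<Gamma>))"
| "alg fv (If E C1 C2) = (\<lambda>p \<Gamma>. let t = tE fv E \<Gamma> in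
    if_env (asgn C1 \<union> asgn C2) t \<Gamma> (alg fv C1 (p * t) \<Gamma>) (alg fv C2 (p * t) \<Gamma>))"
| "alg fv (While E C) = (\<lambda>p \<Gamma>. let \<Gamma>s = lfp (\<lambda>\<Theta>. sup \<Gamma> (alg fv C (p * tE fv E \<Theta>) \<Theta>)) in
    while_env (asgn C) (tE fv E \<Gamma>s) \<Gamma>s)"

lemma tE_mono: "\<Gamma> \<le> \<Gamma>' \<Longrightarrow> tE fv E \<Gamma> \<le> tE fv E \<Gamma>'"
  unfolding tE_def by (intro qprod_mono) (simp add: le_fun_def)

lemma alg_mono: "p \<le> p' \<Longrightarrow> \<Gamma> \<le> \<Gamma>' \<Longrightarrow> alg fv C p \<Gamma> \<le> alg fv C p' \<Gamma>'"
proof (induction C arbitrary: p p' \<Gamma> \<Gamma>')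
  case (Assign x E)
  then show ?case by (auto simp: le_fun_def intro!: qmult_mono tE_mono)
next
  case (If E C1 C2)
  have t: "tE fv E \<Gamma> \<le> tE fv E \<Gamma>'" using If.prems by (intro tE_mono)
  then have "p * tE fv E \<Gamma> \<le> p' * tE fv E \<Gamma>'" using If.prems by (intro qmult_mono)
  note IH = this[THEN If.IH(1), OF If.prems(2)] this[THEN If.IH(2), OF If.prems(2)]
  show ?case using t IH If.prems(2)
    by (auto simp: le_fun_def if_env_def Let_def intro!: qmult_mono sup_mono)
next
  case (While E C)
  let ?G = "\<lambda>p \<Gamma>. lfp (\<lambda>\<Theta>. sup \<Gamma> (alg fv C (p * tE fv E \<Theta>) \<Theta>))"
  have G: "?G p \<Gamma> \<le> ?G p' \<Gamma>'"
    using While.prems by (intro lfp_mono sup_mono While.IH qmult_mono order_refl)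
  then have t: "tE fv E (?G p \<Gamma>) \<le> tE fv E (?G p' \<Gamma>')" by (rule tE_mono)
  show ?case using G qstar_mono[OF t]
    by (auto simp: le_fun_def while_env_def Let_def intro!: qmult_mono)
qed simp_all

lemma mono_alg_step: "mono (\<lambda>\<Theta>. sup \<Gamma> (alg fv C (p * tE fv E \<Theta>) \<Theta>))"
  by (intro monoI sup_mono order_refl alg_mono qmult_mono tE_mono)

definition Delta :: "('e \<Rightarrow> 'v::finite set) \<Rightarrow> ('v, 'e) com \<Rightarrow> 'v \<Rightarrow> 'v setobj" where
  "Delta fv C = alg fv C 1 gen"

definition obs :: "('e \<Rightarrow> 'v::finite set) \<Rightarrow> ('v, 'e) com \<Rightarrow> 'v set \<Rightarrow> 'v setobj" where
  "obs fv C W = (\<Prod>w\<in>W. Delta fv C w)"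

end

theory Submission
  imports Defs
begin

text \<open>The labelling \<open>alpha \<sigma>\<close> preserves joins and the unit and satisfies
  \<open>\<alpha>(\<X> \<otimes> \<Y>) \<sqsubseteq> \<alpha>(\<X>) \<otimes> \<alpha>(\<Y>)\<close>, which propagates through the algorithmic system. Equality holds
  when the labels are idempotent, since then repeated occurrences of a variable cost nothing.
  For soundness, every variable after running \<open>C\<close> depends on the initial store only through a mix
  of the kernels of the restrictions to members of \<open>Delta fv C w\<close>. The mixing follows the control
  flow: within a cell of the guard the branch, or the number of iterations, is fixed. A legal
  mediator family pulls such a mix on stores back to a member of the mix that defines \<open>alpha \<sigma>\<close>.\<close>

section \<open>Monotonicity and distributivity in commutative quantales\<close>

lemma Sup_preserving_mono:
  fixes h :: "'a::complete_lattice \<Rightarrow> 'b::complete_lattice"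
  assumes "\<And>A. h (Sup A) = (SUP x\<in>A. h x)"
  shows "mono h"
proof (rule monoI)
  fix x y :: 'a assume "x \<le> y"
  then have "h y = sup (h x) (h y)"
    using assms[of "{x, y}"] by (simp add: sup_absorb2)
  then show "h x \<le> h y" by (metis sup_ge1)
qed

text \<open>The additional factors multiply to something above \<open>1\<close>, so labels in
  \<open>M1\<close> may be charged for extra variables.\<close>

lemma prod_superset_mono:
  fixes f :: "'a \<Rightarrow> 'm::comm_quantale"
  assumes "finite B" and "A \<subseteq> B" and "\<And>x. x \<in> B \<Longrightarrow> 1 \<le> f x"
  shows "prod f A \<le> prod f B"
proof -
  have "1 \<le> prod f (B - A)"
    using qprod_mono[of "B - A" "\<lambda>_. 1" f] assms(3) by simp
  then have "1 * prod f A \<le> prod f (B - A) * prod f A"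
    by (intro qmult_mono order_refl)
  then show ?thesis using prod.subset_diff[OF assms(2,1), of f] by simp
qed

lemma mult_SUP_SUP:
  fixes f :: "'a \<Rightarrow> 'm::comm_quantale"
  shows "(SUP x\<in>A. f x) * (SUP y\<in>B. g y) = (SUP x\<in>A. SUP y\<in>B. f x * g y)"
proof -
  have "(SUP x\<in>A. f x) * z = (SUP x\<in>A. f x * z)" for z
    using mult_Sup_distrib[of z "f ` A"] by (simp add: image_image mult.commute)
  moreover have "x * (SUP y\<in>B. g y) = (SUP y\<in>B. x * g y)" for x
    using mult_Sup_distrib[of x "g ` B"] by (simp add: image_image)
  ultimately show ?thesis by (simp only: SUP_commute[of _ B])
qed

section \<open>Comparing algorithmic typings along maps of quantales\<close>

context
  fixes h :: "'m::comm_quantale \<Rightarrow> 'n::comm_quantale"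
  assumes Sup: "\<And>A. h (Sup A) = (SUP x\<in>A. h x)"
    and one: "h 1 \<le> 1"
    and mult: "\<And>x y. h (x * y) \<le> h x * h y"
begin

lemma lax_prod: "h (prod f A) \<le> (\<Prod>x\<in>A. h (f x))"
  by (induction A rule: infinite_finite_induct)
    (auto simp: one intro: order_trans[OF mult] qmult_mono)

lemma lax_power: "h (x ^ n) \<le> h x ^ n"
  by (induction n) (auto simp: one intro: order_trans[OF mult] qmult_mono)

lemma lax_qstar: "h (qstar x) \<le> qstar (h x)"
  unfolding qstar_def Sup image_image by (intro SUP_mono) (auto intro: lax_power)

lemma lax_sup: "h (sup x y) = sup (h x) (h y)"
  using Sup[of "{x, y}"] by simp

lemma lax_tE: "h (tE fv E \<Gamma>) \<le> tE fv E (h \<circ> \<Gamma>)"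
  unfolding tE_def by (simp add: lax_prod)

lemma lax_tE_comp: "h (tE fv E \<Gamma>) \<le> tE fv E (\<lambda>v. h (\<Gamma> v))"
  using lax_tE by (simp add: comp_def)

text \<open>The operations of the algorithm are monotone, so moving \<open>h\<close> inward past
  products and joins, construct by construct, only enlarges the result. Preservation of arbitrary
  joins carries \<open>h\<close> past \<open>qstar\<close> and the least fixed point.\<close>

lemma lax_alg: "h \<circ> alg fv C p \<Gamma> \<le> alg fv C (h p) (h \<circ> \<Gamma>)"
proof (induction C arbitrary: p \<Gamma>)
  case (Assign x E)
  then show ?case
    by (auto simp: le_fun_def intro!: order_trans[OF mult] qmult_mono lax_tE lax_tE_comp)
next
  case (Seq C1 C2)
  have "h \<circ> alg fv C2 p (alg fv C1 p \<Gamma>) \<le> alg fv C2 (h p) (h \<circ> alg fv C1 p \<Gamma>)"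
    by (rule Seq.IH)
  also have "\<dots> \<le> alg fv C2 (h p) (alg fv C1 (h p) (h \<circ> \<Gamma>))"
    by (intro alg_mono order_refl Seq.IH)
  finally show ?case by (simp only: alg.simps)
next
  case (If E C1 C2)
  have pt: "h (p * tE fv E \<Gamma>) \<le> h p * tE fv E (h \<circ> \<Gamma>)"
    by (rule order_trans[OF mult qmult_left_mono[OF lax_tE]])
  have 1: "h \<circ> alg fv C1 (p * tE fv E \<Gamma>) \<Gamma> \<le> alg fv C1 (h p * tE fv E (h \<circ> \<Gamma>)) (h \<circ> \<Gamma>)"
    by (rule order_trans[OF If.IH(1) alg_mono[OF pt order_refl]])
  have 2: "h \<circ> alg fv C2 (p * tE fv E \<Gamma>) \<Gamma> \<le> alg fv C2 (h p * tE fv E (h \<circ> \<Gamma>)) (h \<circ> \<Gamma>)"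
    by (rule order_trans[OF If.IH(2) alg_mono[OF pt order_refl]])
  show ?case
    using 1 2 by (auto simp: le_fun_def if_env_def Let_def lax_sup comp_def simp del: sup.bounded_iff
        intro!: order_trans[OF mult] qmult_mono lax_tE_comp sup_mono)
next
  case (While E C)
  let ?F = "\<lambda>\<Theta>. sup \<Gamma> (alg fv C (p * tE fv E \<Theta>) \<Theta>)"
  let ?G = "\<lambda>\<Theta>. sup (h \<circ> \<Gamma>) (alg fv C (h p * tE fv E \<Theta>) \<Theta>)"
  have fix_le: "h \<circ> lfp ?F \<le> lfp ?G"
  \<comment> \<open>The bound is propagated along the approximants of \<open>lfp ?F\<close>; it
    survives suprema because \<open>h\<close> preserves joins.\<close>
  proof (rule lfp_ordinal_induct[where f = ?F, OF mono_alg_step])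
    fix \<Theta> assume \<Theta>: "h \<circ> \<Theta> \<le> lfp ?G"
    have "h (p * tE fv E \<Theta>) \<le> h p * tE fv E (h \<circ> \<Theta>)"
      by (rule order_trans[OF mult qmult_left_mono[OF lax_tE]])
    also have "\<dots> \<le> h p * tE fv E (lfp ?G)"
      by (rule qmult_left_mono[OF tE_mono[OF \<Theta>]])
    finally have "h \<circ> alg fv C (p * tE fv E \<Theta>) \<Theta> \<le> alg fv C (h p * tE fv E (lfp ?G)) (lfp ?G)"
      by (rule order_trans[OF While.IH alg_mono[OF _ \<Theta>]])
    then have "h \<circ> ?F \<Theta> \<le> ?G (lfp ?G)"
      by (auto simp: le_fun_def lax_sup intro: le_supI1 le_supI2)
    then show "h \<circ> ?F \<Theta> \<le> lfp ?G"
      using lfp_unfold[OF mono_alg_step[of "h \<circ> \<Gamma>" fv C "h p" E]] by simp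
  next
    fix M assume "\<forall>\<Theta>\<in>M. h \<circ> \<Theta> \<le> lfp ?G"
    then show "h \<circ> Sup M \<le> lfp ?G"
      by (auto simp: le_fun_def Sup image_image intro!: SUP_least)
  qed
  have t: "h (tE fv E (lfp ?F)) \<le> tE fv E (lfp ?G)"
    by (rule order_trans[OF lax_tE tE_mono[OF fix_le]])
  show ?case
    using fix_le order_trans[OF lax_qstar qstar_mono[OF t]]
    by (auto simp: le_fun_def while_env_def Let_def comp_def
        intro!: order_trans[OF mult] qmult_mono)
qed simp

end

context
  fixes h :: "'m::comm_quantale \<Rightarrow> 'n::comm_quantale"
  assumes mono: "mono h"
    and one: "1 \<le> h 1"
    and mult: "\<And>x y. h x * h y \<le> h (x * y)"
begin

lemma oplax_prod: "(\<Prod>x\<in>A. h (f x)) \<le> h (prod f A)"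
  by (induction A rule: infinite_finite_induct)
    (auto simp: one intro: order_trans[OF _ mult] qmult_mono)

lemma oplax_power: "h x ^ n \<le> h (x ^ n)"
  by (induction n) (auto simp: one intro: order_trans[OF _ mult] qmult_mono)

lemma oplax_qstar: "qstar (h x) \<le> h (qstar x)"
  unfolding qstar_def
  by (intro SUP_least order_trans[OF oplax_power] monoD[OF mono] SUP_upper) simp

lemma oplax_sup: "sup (h x) (h y) \<le> h (sup x y)"
  by (intro sup_least monoD[OF mono]) simp_all

lemma oplax_tE: "tE fv E (h \<circ> \<Gamma>) \<le> h (tE fv E \<Gamma>)"
  unfolding tE_def by (simp add: oplax_prod)

lemma oplax_tE_comp: "tE fv E (\<lambda>v. h (\<Gamma> v)) \<le> h (tE fv E \<Gamma>)"
  using oplax_tE by (simp add: comp_def)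

text \<open>The same induction with all inequalities reversed. Monotonicity of \<open>h\<close>
  handles joins, and also the fixed point, because \<open>h \<circ> lfp ?F\<close> is a pre-fixed
  point of \<open>?G\<close>.\<close>

lemma oplax_alg: "alg fv C (h p) (h \<circ> \<Gamma>) \<le> h \<circ> alg fv C p \<Gamma>"
proof (induction C arbitrary: p \<Gamma>)
  case (Assign x E)
  then show ?case
    by (auto simp: le_fun_def intro!: order_trans[OF _ mult] qmult_mono oplax_tE oplax_tE_comp)
next
  case (Seq C1 C2)
  have "alg fv C2 (h p) (alg fv C1 (h p) (h \<circ> \<Gamma>)) \<le> alg fv C2 (h p) (h \<circ> alg fv C1 p \<Gamma>)"
    by (intro alg_mono order_refl Seq.IH)
  also have "\<dots> \<le> h \<circ> alg fv C2 p (alg fv C1 p \<Gamma>)"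
    by (rule Seq.IH)
  finally show ?case by (simp only: alg.simps)
next
  case (If E C1 C2)
  have pt: "h p * tE fv E (h \<circ> \<Gamma>) \<le> h (p * tE fv E \<Gamma>)"
    by (rule order_trans[OF qmult_left_mono[OF oplax_tE] mult])
  have 1: "alg fv C1 (h p * tE fv E (h \<circ> \<Gamma>)) (h \<circ> \<Gamma>) \<le> h \<circ> alg fv C1 (p * tE fv E \<Gamma>) \<Gamma>"
    by (rule order_trans[OF alg_mono[OF pt order_refl] If.IH(1)])
  have 2: "alg fv C2 (h p * tE fv E (h \<circ> \<Gamma>)) (h \<circ> \<Gamma>) \<le> h \<circ> alg fv C2 (p * tE fv E \<Gamma>) \<Gamma>"
    by (rule order_trans[OF alg_mono[OF pt order_refl] If.IH(2)])
  have "sup (alg fv C1 (h p * tE fv E (h \<circ> \<Gamma>)) (h \<circ> \<Gamma>) x)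
      (alg fv C2 (h p * tE fv E (h \<circ> \<Gamma>)) (h \<circ> \<Gamma>) x)
      \<le> h (sup (alg fv C1 (p * tE fv E \<Gamma>) \<Gamma> x) (alg fv C2 (p * tE fv E \<Gamma>) \<Gamma> x))" for x
    by (rule order_trans[OF sup_mono oplax_sup]) (use 1 2 in \<open>auto simp: le_fun_def\<close>)
  then show ?case
    by (auto simp: le_fun_def if_env_def Let_def comp_def simp del: sup.bounded_iff
        intro!: order_trans[OF _ mult] qmult_mono oplax_tE_comp)
next
  case (While E C)
  let ?F = "\<lambda>\<Theta>. sup \<Gamma> (alg fv C (p * tE fv E \<Theta>) \<Theta>)"
  let ?G = "\<lambda>\<Theta>. sup (h \<circ> \<Gamma>) (alg fv C (h p * tE fv E \<Theta>) \<Theta>)"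
  have fix_le: "lfp ?G \<le> h \<circ> lfp ?F"
  proof (rule lfp_lowerbound)
    have "h p * tE fv E (h \<circ> lfp ?F) \<le> h (p * tE fv E (lfp ?F))"
      by (rule order_trans[OF qmult_left_mono[OF oplax_tE] mult])
    then have "alg fv C (h p * tE fv E (h \<circ> lfp ?F)) (h \<circ> lfp ?F)
        \<le> h \<circ> alg fv C (p * tE fv E (lfp ?F)) (lfp ?F)"
      by (rule order_trans[OF alg_mono[OF _ order_refl] While.IH])
    then have "?G (h \<circ> lfp ?F) v \<le> (h \<circ> ?F (lfp ?F)) v" for v
      using order_trans[OF sup_mono[OF order_refl] oplax_sup]
      by (simp add: le_fun_def del: sup.bounded_iff)
    then have "?G (h \<circ> lfp ?F) \<le> h \<circ> ?F (lfp ?F)" by (rule le_funI)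
    then show "?G (h \<circ> lfp ?F) \<le> h \<circ> lfp ?F"
      using lfp_unfold[OF mono_alg_step[of \<Gamma> fv C p E]] by simp
  qed
  have t: "tE fv E (lfp ?G) \<le> h (tE fv E (lfp ?F))"
    by (rule order_trans[OF tE_mono[OF fix_le] oplax_tE])
  show ?case
    using fix_le order_trans[OF qstar_mono[OF t] oplax_qstar]
    by (auto simp: le_fun_def while_env_def Let_def comp_def
        intro!: order_trans[OF _ mult] qmult_mono)
qed simp

end

text \<open>\<open>Sub\<close> is absorbed by \<open>alg_mono\<close>. For loops, the induction
  hypothesis makes the invariant \<Gamma> a pre-fixed point of the step function, hence above the
  least one.\<close>

lemma alg_le_typed: "typed fv p \<Gamma> C \<Gamma>' \<Longrightarrow> alg fv C p \<Gamma> \<le> \<Gamma>'"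
proof (induction rule: typed.induct)
  case (Seq p \<Gamma> C1 \<Gamma>'' C2 \<Gamma>')
  have "alg fv C2 p (alg fv C1 p \<Gamma>) \<le> alg fv C2 p \<Gamma>''"
    by (intro alg_mono order_refl Seq.IH)
  then show ?case using Seq.IH by simp
next
  case (If p t E \<Gamma> C1 \<Gamma>1 C2 \<Gamma>2)
  then show ?case
    by (auto simp: le_fun_def if_env_def Let_def simp del: sup.bounded_iff
        intro!: qmult_mono sup_mono)
next
  case (While p t E \<Gamma> C)
  let ?\<Theta> = "lfp (\<lambda>\<Theta>. sup \<Gamma> (alg fv C (p * tE fv E \<Theta>) \<Theta>))"
  have fix_le: "?\<Theta> \<le> \<Gamma>"
    using While by (intro lfp_lowerbound) simp
  have "qstar (tE fv E ?\<Theta>) \<le> qstar t"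
    using tE_mono[OF fix_le, of fv E] While by (simp add: qstar_mono)
  then show ?case using fix_le
    by (auto simp: le_fun_def while_env_def Let_def intro!: qmult_mono)
next
  case (Sub p' \<Gamma>' p \<Gamma> C \<Gamma>1 \<Gamma>2)
  then show ?case by (meson alg_mono order_trans)
qed simp_all

section \<open>The labelling of the set object\<close>

lemma alpha_Sup: "alpha \<sigma> (Sup A) = (SUP \<X>\<in>A. alpha \<sigma> \<X>)"
  by (simp add: alpha_def Sup_setobj.rep_eq SUP_UNION)

lemma alpha_one: "alpha \<sigma> 1 = 1"
  by (simp add: alpha_def one_setobj.rep_eq)

text \<open>\<open>Pow {v}\<close> also contains \<open>{}\<close>, whose empty product
  \<open>1\<close> is absorbed by the label.\<close>

lemma alpha_gen: "1 \<le> \<sigma> v \<Longrightarrow> alpha \<sigma> (gen v) = \<sigma> v"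
  by (simp add: alpha_def gen.rep_eq Pow_insert sup_absorb1)

text \<open>A variable in both \<open>X\<close> and \<open>Y\<close> is charged once on the left and
  twice on the right; labels lie above \<open>1\<close>, so the second charge only enlarges.\<close>

lemma alpha_mult_le:
  assumes "\<And>v. 1 \<le> \<sigma> v"
  shows "alpha \<sigma> (\<X> * \<Y>) \<le> alpha \<sigma> \<X> * alpha \<sigma> \<Y>"
  unfolding alpha_def
proof (rule SUP_least)
  fix Z assume "Z \<in> setobj_sets (\<X> * \<Y>)"
  then obtain X Y where XY: "X \<in> setobj_sets \<X>" "Y \<in> setobj_sets \<Y>" "Z \<subseteq> X \<union> Y"
    by (auto simp: times_setobj.rep_eq union_down_def)
  have "prod \<sigma> Z \<le> prod \<sigma> (X \<union> (Y - X))"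
    using XY(3) by (intro prod_superset_mono) (auto simp: assms)
  also have "\<dots> = prod \<sigma> X * prod \<sigma> (Y - X)"
    by (rule prod.union_disjoint) auto
  also have "\<dots> \<le> prod \<sigma> X * prod \<sigma> Y"
    by (intro qmult_left_mono prod_superset_mono) (auto simp: assms)
  also have "\<dots> \<le> (SUP X\<in>setobj_sets \<X>. prod \<sigma> X) * (SUP Y\<in>setobj_sets \<Y>. prod \<sigma> Y)"
    using XY by (intro qmult_mono SUP_upper)
  finally show "prod \<sigma> Z \<le> \<dots>" .
qed

text \<open>Both factors are below the product over \<open>X \<union> Y\<close>, and idempotence
  collapses its square.\<close>

lemma alpha_mult_ge:
  assumes "\<And>v. 1 \<le> \<sigma> v" and idem: "\<And>v. \<sigma> v * \<sigma> v = \<sigma> v"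
  shows "alpha \<sigma> \<X> * alpha \<sigma> \<Y> \<le> alpha \<sigma> (\<X> * \<Y>)"
  unfolding alpha_def mult_SUP_SUP
proof (intro SUP_least)
  fix X Y assume XY: "X \<in> setobj_sets \<X>" "Y \<in> setobj_sets \<Y>"
  have "prod \<sigma> X * prod \<sigma> Y \<le> prod \<sigma> (X \<union> Y) * prod \<sigma> (X \<union> Y)"
    by (intro qmult_mono prod_superset_mono) (auto simp: assms)
  also have "\<dots> = prod \<sigma> (X \<union> Y)"
    by (simp add: prod.distrib[symmetric] idem)
  also have "\<dots> \<le> (SUP Z\<in>setobj_sets (\<X> * \<Y>). prod \<sigma> Z)"
    using XY by (intro SUP_upper) (auto simp: times_setobj.rep_eq union_down_def)
  finally show "prod \<sigma> X * prod \<sigma> Y \<le> \<dots>" .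
qed

text \<open>\<open>alpha \<sigma>\<close> sends the initial environment \<open>gen\<close> to
  \<sigma>, so the lax comparison applies to \<open>Delta\<close> as well as to the product over
  \<open>W\<close>.\<close>

lemma alpha_obs_le:
  assumes "\<And>v. 1 \<le> \<sigma> v"
  shows "alpha \<sigma> (obs fv C W) \<le> (\<Prod>w\<in>W. alg fv C 1 \<sigma> w)"
proof -
  have g: "alpha \<sigma> \<circ> gen = \<sigma>" using assms by (simp add: fun_eq_iff alpha_gen)
  have one: "alpha \<sigma> 1 \<le> 1" by (simp add: alpha_one)
  have "alpha \<sigma> (obs fv C W) \<le> (\<Prod>w\<in>W. alpha \<sigma> (Delta fv C w))"
    unfolding obs_def by (rule lax_prod[where h = "alpha \<sigma>", OF alpha_Sup one alpha_mult_le[OF assms]])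
  also have "\<dots> \<le> (\<Prod>w\<in>W. alg fv C 1 \<sigma> w)"
    using lax_alg[where h = "alpha \<sigma>", OF alpha_Sup one alpha_mult_le[OF assms], of fv C 1 gen]
    by (intro qprod_mono) (simp add: g le_fun_def alpha_one Delta_def)
  finally show ?thesis .
qed

lemma alpha_obs_ge:
  assumes "\<And>v. 1 \<le> \<sigma> v" and "\<And>v. \<sigma> v * \<sigma> v = \<sigma> v"
  shows "(\<Prod>w\<in>W. alg fv C 1 \<sigma> w) \<le> alpha \<sigma> (obs fv C W)"
proof -
  have g: "alpha \<sigma> \<circ> gen = \<sigma>" using assms by (simp add: fun_eq_iff alpha_gen)
  have one: "1 \<le> alpha \<sigma> 1" by (simp add: alpha_one)
  note mono = Sup_preserving_mono[OF alpha_Sup[of \<sigma>]]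
  have "(\<Prod>w\<in>W. alg fv C 1 \<sigma> w) \<le> (\<Prod>w\<in>W. alpha \<sigma> (Delta fv C w))"
    using oplax_alg[where h = "alpha \<sigma>", OF mono one alpha_mult_ge[OF assms], of fv C 1 gen]
    by (intro qprod_mono) (simp add: g le_fun_def alpha_one Delta_def)
  also have "\<dots> \<le> alpha \<sigma> (obs fv C W)"
    unfolding obs_def by (rule oplax_prod[where h = "alpha \<sigma>", OF mono one alpha_mult_ge[OF assms]])
  finally show ?thesis .
qed

text \<open>The command \<open>if v (v := v) skip\<close> charges \<open>v\<close> three times in \<open>M\<close>, but only once in the
  set object.\<close>

lemma idempotent_if_agree:
  fixes \<sigma> :: "'v::finite \<Rightarrow> 'm::comm_quantale"
  assumes \<sigma>: "\<And>v. 1 \<le> \<sigma> v" and E: "fv E = {v}"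
    and agree: "\<And>C W. alpha \<sigma> (obs fv C W) = (\<Prod>w\<in>W. alg fv C 1 \<sigma> w)"
  shows "\<sigma> v * \<sigma> v = \<sigma> v"
proof -
  let ?C = "If E (Assign v E) Skip"
  have gg: "gen v * gen v = gen v"
    by transfer (auto simp: union_down_def)
  have sq: "\<sigma> v \<le> \<sigma> v * \<sigma> v"
    using qmult_left_mono[OF \<sigma>, of "\<sigma> v" v] by simp
  have "\<sigma> v = alpha \<sigma> (obs fv ?C {v})"
    by (simp add: obs_def Delta_def if_env_def tE_def E gg alpha_gen \<sigma> Let_def)
  \<comment> \<open>The factors come from the guard in the final environment, the raised program
    counter, and the assigned expression. The value from the \<open>Skip\<close> branch is absorbed
    by \<open>sq\<close>.\<close>
  also have "\<dots> = \<sigma> v * (\<sigma> v * \<sigma> v)"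
    using sq unfolding agree by (simp add: if_env_def tE_def E sup_absorb1 Let_def)
  finally have "\<sigma> v * \<sigma> v \<le> \<sigma> v"
    using qmult_left_mono[OF sq, of "\<sigma> v"] by simp
  with sq show ?thesis by (rule antisym[rotated])
qed

section \<open>Functions of the store determined by a set object\<close>

text \<open>An undefined point clashes with nothing, as in \<open>factors_Id\<close>. Stating
  disagreement lets determinacy be transferred by mapping clashes to clashes.\<close>

definition clash :: "('s \<Rightarrow> 'b option) \<Rightarrow> 's \<Rightarrow> 's \<Rightarrow> bool" where
  "clash h s s' \<longleftrightarrow> (\<exists>b b'. h s = Some b \<and> h s' = Some b' \<and> b \<noteq> b')"

lemma clashI: "h s = Some b \<Longrightarrow> h s' = Some b' \<Longrightarrow> b \<noteq> b' \<Longrightarrow> clash h s s'"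
  by (auto simp: clash_def)

text \<open>The sets \<open>X s\<close> describe a mix of the kernels of the restrictions to the members of \<open>\<X>\<close>: the
  cell of \<open>s\<close> consists of the stores that agree with \<open>s\<close> on \<open>X s\<close>.\<close>

definition selector :: "'v setobj \<Rightarrow> (('v \<Rightarrow> 'val) \<Rightarrow> 'v set) \<Rightarrow> (('v \<Rightarrow> 'val) \<Rightarrow> 'b option) \<Rightarrow> bool" where
  "selector \<X> X h \<longleftrightarrow> (\<forall>s. X s \<in> setobj_sets \<X>) \<and>
    (\<forall>s s'. (\<forall>v\<in>X s. s v = s' v) \<longrightarrow> X s' = X s \<and> \<not> clash h s s')"

lemma selectorD:
  assumes "selector \<X> X h"
  shows "X s \<in> setobj_sets \<X>"
    and "\<forall>v\<in>X s. s v = s' v \<Longrightarrow> X s' = X s"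
    and "\<forall>v\<in>X s. s v = s' v \<Longrightarrow> \<not> clash h s s'"
  using assms unfolding selector_def by blast+

definition determined :: "'v setobj \<Rightarrow> (('v \<Rightarrow> 'val) \<Rightarrow> 'b option) \<Rightarrow> bool" where
  "determined \<X> h \<longleftrightarrow> (\<exists>X. selector \<X> X h)"

lemma setobj_Un: "X \<in> setobj_sets \<X> \<Longrightarrow> Y \<in> setobj_sets \<Y> \<Longrightarrow> X \<union> Y \<in> setobj_sets (\<X> * \<Y>)"
  by (auto simp: times_setobj.rep_eq union_down_def)

lemma setobj_UN_power:
  "(\<And>i. X i \<in> setobj_sets \<X>) \<Longrightarrow> (\<Union>i<n. X i) \<in> setobj_sets (\<X> ^ n)"
  by (induction n) (auto simp: one_setobj.rep_eq lessThan_Suc intro: setobj_Un)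

lemma setobj_qstar: "X \<in> setobj_sets (\<X> ^ n) \<Longrightarrow> X \<in> setobj_sets (qstar \<X>)"
  by (auto simp: qstar_def Sup_setobj.rep_eq)

lemma determined_weaken:
  assumes "determined \<X> h" and "\<X> \<le> \<Y>" and "\<And>s s'. clash h' s s' \<Longrightarrow> clash h s s'"
  shows "determined \<Y> h'"
proof -
  obtain X where "selector \<X> X h" using assms(1) by (auto simp: determined_def)
  then have "selector \<Y> X h'"
    using assms(2,3) unfolding selector_def less_eq_setobj.rep_eq by blast
  then show ?thesis by (auto simp: determined_def)
qed

text \<open>A selector needs some member to choose, and a nonempty downset contains
  \<open>{}\<close>. This keeps program counters above \<open>1\<close> under guards.\<close>

lemma determined_one_le: "determined \<X> h \<Longrightarrow> 1 \<le> \<X>"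
proof -
  assume "determined \<X> h"
  then obtain X where "X \<in> setobj_sets \<X>" by (auto simp: determined_def selector_def)
  then have "{} \<in> setobj_sets \<X>" using setobj_sets[of \<X>] by auto
  then show ?thesis by (simp add: less_eq_setobj.rep_eq one_setobj.rep_eq)
qed

lemma setobj_UN_prod:
  assumes "finite A" and "\<And>v. v \<in> A \<Longrightarrow> X v \<in> setobj_sets (\<Gamma> v)"
  shows "(\<Union>v\<in>A. X v) \<in> setobj_sets (\<Prod>v\<in>A. \<Gamma> v)"
  using assms by (induction A) (auto simp: one_setobj.rep_eq intro: setobj_Un)

text \<open>The selectors are united: agreement on the union is agreement for every factor at
  once.\<close>

lemma determined_prod:
  assumes "finite A" and "\<And>v. v \<in> A \<Longrightarrow> determined (\<Gamma> v) (h v)"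
    and clash: "\<And>s s'. clash f s s' \<Longrightarrow> \<exists>v\<in>A. clash (h v) s s'"
  shows "determined (\<Prod>v\<in>A. \<Gamma> v) f"
proof -
  obtain X where X: "selector (\<Gamma> v) (X v) (h v)" if "v \<in> A" for v
    using assms(2) unfolding determined_def by metis
  have "selector (\<Prod>v\<in>A. \<Gamma> v) (\<lambda>s. \<Union>v\<in>A. X v s) f"
    unfolding selector_def
  proof (intro conjI allI impI)
    show "(\<Union>v\<in>A. X v s) \<in> setobj_sets (\<Prod>v\<in>A. \<Gamma> v)" for s
      by (intro setobj_UN_prod assms(1) selectorD(1)[OF X])
  next
    fix s s' :: "'b \<Rightarrow> 'c" assume "\<forall>w\<in>\<Union>v\<in>A. X v s. s w = s' w"
    have *: "X v s' = X v s \<and> \<not> clash (h v) s s'" if "v \<in> A" for v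
      using selectorD(2,3)[OF X[OF that], of s s'] that \<open>\<forall>w\<in>_. s w = s' w\<close> by blast
    show "(\<Union>v\<in>A. X v s') = (\<Union>v\<in>A. X v s)" using * by simp
    show "\<not> clash f s s'" using * clash by blast
  qed
  then show ?thesis by (auto simp: determined_def)
qed

text \<open>On each cell of the guard, the selector follows the branch that the guard takes at its
  defined points.\<close>

lemma determined_cond:
  assumes "determined t c" and "determined \<X> h1" and "determined \<X> h2"
    and cond: "\<And>s b. h s = Some b \<Longrightarrow>
      \<exists>g. c s = Some g \<and> (if g then h1 s else h2 s) = Some b"
  shows "determined (t * \<X>) h"
proof -
  obtain T X1 X2 where "selector t T c" and "selector \<X> X1 h1" and "selector \<X> X2 h2"
    using assms(1-3) by (auto simp: determined_def)
  note T = selectorD[OF this(1)] and X1 = selectorD[OF this(2)] and X2 = selectorD[OF this(3)]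
  \<comment> \<open>The guard may be undefined at \<open>s\<close> itself; searching the whole cell
    makes \<open>b\<close> constant on it. If the guard is defined nowhere in the cell, neither is
    \<open>h\<close>, and the default branch is harmless.\<close>
  define b where "b s \<longleftrightarrow> (\<exists>s'. (\<forall>v\<in>T s. s v = s' v) \<and> c s' = Some True)" for s
  have b_Some: "b s = g" if "c s = Some g" for s g
  proof (cases g)
    case True
    with that have "b s" unfolding b_def by (intro exI[of _ s]) simp
    with True show ?thesis by simp
  next
    case False
    have "\<not> b s"
    proof
      assume "b s"
      then obtain s' where "\<forall>v\<in>T s. s v = s' v" "c s' = Some True" unfolding b_def by blast
      moreover have "c s = Some False" using that False by simp
      ultimately show False using T(3)[of s s'] clashI[of c s False s' True] by simp
    qed
    with False show ?thesis by simp
  qed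
  have b_cong: "b s' = b s" if "\<forall>v\<in>T s. s v = s' v" for s s'
    unfolding b_def T(2)[OF that] using that by simp
  have "selector (t * \<X>) (\<lambda>s. T s \<union> (if b s then X1 s else X2 s)) h"
    unfolding selector_def
  proof (intro conjI allI impI)
    show "T s \<union> (if b s then X1 s else X2 s) \<in> setobj_sets (t * \<X>)" for s
      using T(1) X1(1) X2(1) by (auto intro: setobj_Un)
  next
    fix s s' assume "\<forall>v\<in>T s \<union> (if b s then X1 s else X2 s). s v = s' v"
    then have Ts: "\<forall>v\<in>T s. s v = s' v" and Xs: "\<forall>v\<in>if b s then X1 s else X2 s. s v = s' v"
      by auto
    show "T s' \<union> (if b s' then X1 s' else X2 s') = T s \<union> (if b s then X1 s else X2 s)"
      using T(2)[OF Ts] b_cong[OF Ts] Xs X1(2)[of s s'] X2(2)[of s s'] by (auto split: if_splits)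
    have "\<not> clash (if b s then h1 else h2) s s'"
      using Xs X1(3)[of s s'] X2(3)[of s s'] by (auto split: if_splits)
    moreover have "(if b s then h1 else h2) u = Some y" if "h u = Some y" "u \<in> {s, s'}" for u y
      using cond[OF that(1)] b_Some[of u] b_cong[OF Ts] that(2) by (auto split: if_splits)
    ultimately show "\<not> clash h s s'" unfolding clash_def by blast
  qed
  then show ?thesis by (auto simp: determined_def)
qed

text \<open>Every element of the union appears at some stage, and finiteness of the type gives a
  largest such stage.\<close>

lemma increasing_sets_stabilize:
  fixes U :: "nat \<Rightarrow> 'v::finite set"
  assumes "\<And>i j. i \<le> j \<Longrightarrow> U i \<subseteq> U j"
  obtains N where "(\<Union>i. U i) = U N"
proof -
  have "\<exists>n. v \<in> U n" if "v \<in> (\<Union>i. U i)" for v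
    using that by blast
  then obtain n where n: "v \<in> U (n v)" if "v \<in> (\<Union>i. U i)" for v by metis
  have "(\<Union>i. U i) \<subseteq> U (Max (range n))"
  proof
    fix v assume "v \<in> (\<Union>i. U i)"
    moreover have "U (n v) \<subseteq> U (Max (range n))" by (intro assms Max_ge) auto
    ultimately show "v \<in> U (Max (range n))" using n by blast
  qed
  then show thesis using that by (metis UN_upper UNIV_I antisym)
qed

text \<open>Here \<open>c i\<close> is the guard and \<open>h i\<close> the observation after \<open>i\<close> iterations. The cell of \<open>s\<close> is
  refined until it contains a store at which the loop stops. By determinacy of the guards all
  terminating stores in this cell stop at the same iteration. If this never happens, the
  refinement still stabilizes since there are finitely many variables.\<close>

lemma determined_loop:
  fixes c :: "nat \<Rightarrow> ('v::finite \<Rightarrow> 'val) \<Rightarrow> bool option"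
  assumes c: "\<And>i. determined t (c i)" and h: "\<And>i. determined \<X> (h i)"
    and loop: "\<And>s b. f s = Some b \<Longrightarrow>
      \<exists>n. (\<forall>i<n. c i s = Some True) \<and> c n s = Some False \<and> h n s = Some b"
  shows "determined (qstar t * \<X>) f"
proof -
  have "\<exists>T. \<forall>i. selector t (T i) (c i)" "\<exists>X. \<forall>i. selector \<X> (X i) (h i)"
    using c h unfolding determined_def by metis+
  then obtain T X where TT: "\<And>i. selector t (T i) (c i)" and XX: "\<And>i. selector \<X> (X i) (h i)"
    by blast
  note T = selectorD[OF TT] and X = selectorD[OF XX]
  define U where "U n s = (\<Union>i\<le>n. T i s)" for n s
  \<comment> \<open>Only the guard at index \<open>n\<close> is tested. For a store at which the
    loop terminates, \<open>N_eq\<close> identifies the least such \<open>n\<close> with its number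
    of iterations.\<close>
  define stop where
    "stop n s \<longleftrightarrow> (\<exists>s'. (\<forall>v\<in>U n s. s v = s' v) \<and> c n s' = Some False)" for n s
  define N where "N s = (LEAST n. stop n s)" for s
  \<comment> \<open>Without a stopping store \<open>f\<close> is undefined on the cell, so index
    \<open>0\<close> only supplies some member of \<open>\<X>\<close>.\<close>
  define Z where "Z s = (if \<exists>n. stop n s then U (N s) s \<union> X (N s) s else (\<Union>n. U n s) \<union> X 0 s)" for s
  have U_mono: "U i s \<subseteq> U j s" if "i \<le> j" for i j s
    unfolding U_def using that by (intro UN_mono) auto
  have U_mem: "U n s \<in> setobj_sets (qstar t)" for n s
    unfolding U_def lessThan_Suc_atMost[symmetric]
    \<comment> \<open>Guards \<open>0\<close> to \<open>n\<close> inclusive cost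
      \<open>Suc n\<close> factors of \<open>t\<close>.\<close>
    by (intro setobj_qstar[of _ t "Suc n"] setobj_UN_power T(1))
  have U_cong: "U n s' = U n s" if "\<forall>v\<in>U n s. s v = s' v" for n s s'
    using that T(2)[of _ s s'] unfolding U_def by (intro SUP_cong) auto
  have stop_cong: "stop n s' = stop n s" if "\<forall>v\<in>U n s. s v = s' v" for n s s'
    using U_cong[OF that] that unfolding stop_def by simp
  have N_eq: "stop n s \<and> N s = n" if "\<forall>i<n. c i s = Some True" "c n s = Some False" for n s
  proof
    show st: "stop n s" using that(2) by (auto simp: stop_def)
    have "\<not> stop i s" if "i < n" for i
    proof
      assume "stop i s"
      then obtain s' where "\<forall>v\<in>U i s. s v = s' v" "c i s' = Some False"
        by (auto simp: stop_def)
      moreover have "c i s = Some True" using \<open>i < n\<close> \<open>\<forall>i<n. c i s = Some True\<close> by simp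
      ultimately show False
        using T(3)[of i s s'] clashI[of "c i" s True s' False] by (auto simp: U_def)
    qed
    then show "N s = n" unfolding N_def using st by (intro Least_equality) (auto simp: not_less[symmetric])
  qed
  \<comment> \<open>Agreement on \<open>U (N s) s\<close> covers all earlier stages, so both stores
    have the same least stopping index.\<close>
  have N_cong: "stop n s' = stop n s" if "\<forall>v\<in>U (N s) s. s v = s' v" "n \<le> N s" for n s s'
    using that U_mono[OF that(2)] by (intro stop_cong) auto
  have Z_mem: "Z s \<in> setobj_sets (qstar t * \<X>)" for s
  proof -
    obtain n where "(\<Union>n. U n s) = U n s"
      using increasing_sets_stabilize[of "\<lambda>n. U n s"] U_mono by metis
    then have "(\<Union>n. U n s) \<in> setobj_sets (qstar t)" by (simp add: U_mem)
    then show ?thesis unfolding Z_def using U_mem X(1) by (simp add: setobj_Un)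
  qed
  have "Z s' = Z s \<and> \<not> clash f s s'" if s: "\<forall>v\<in>Z s. s v = s' v" for s s'
  proof (cases "\<exists>n. stop n s")
    case True
    then have Us: "\<forall>v\<in>U (N s) s. s v = s' v" and Xs: "\<forall>v\<in>X (N s) s. s v = s' v"
      using s by (auto simp: Z_def)
    have st: "stop (N s) s" using True unfolding N_def by (rule LeastI_ex)
    then have st': "stop (N s) s'" using N_cong[OF Us] by simp
    have N': "N s' = N s"
      unfolding N_def[of s']
    proof (rule Least_equality)
      show "N s \<le> n" if "stop n s'" for n
      proof (rule ccontr)
        assume "\<not> N s \<le> n"
        then have "stop n s" "n < N s" using N_cong[OF Us, of n] that by auto
        then show False unfolding N_def by (auto dest: not_less_Least)
      qed
    qed (rule st')
    have "Z s' = Z s"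
      using True st' U_cong[OF Us] X(2)[OF Xs] by (auto simp: Z_def N')
    moreover have "\<not> clash f s s'"
    proof
      assume "clash f s s'"
      then obtain b b' where "f s = Some b" "f s' = Some b'" "b \<noteq> b'" by (auto simp: clash_def)
      then have "h (N s) s = Some b" "h (N s) s' = Some b'" "b \<noteq> b'"
        using loop[of s b] loop[of s' b'] N_eq N' by metis+
      then show False using X(3)[OF Xs] clashI by metis
    qed
    ultimately show ?thesis ..
  next
    case False
    then have Us: "\<forall>v\<in>U n s. s v = s' v" and Xs: "\<forall>v\<in>X 0 s. s v = s' v" for n
      using s by (auto simp: Z_def)
    have st': "\<not> (\<exists>n. stop n s')" using False stop_cong[OF Us] by simp
    have "Z s' = Z s"
      using False st' U_cong[OF Us] X(2)[OF Xs] by (simp add: Z_def)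
    moreover have "f s = None"
      using loop[of s] N_eq False by (metis option.exhaust)
    ultimately show ?thesis by (simp add: clash_def)
  qed
  then have "selector (qstar t * \<X>) Z f"
    using Z_mem unfolding selector_def by blast
  then show ?thesis by (auto simp: determined_def)
qed

section \<open>Semantic soundness of the typing in the set object\<close>

text \<open>Fixed-point induction unrolls a terminating loop into the form that
  \<open>determined_loop\<close> expects: the guard holds at iterates below \<open>n\<close> and
  fails at iterate \<open>n\<close>.\<close>

lemma while_sem_iterate:
  assumes "while_sem b f s = Some r"
  shows "\<exists>n. (\<forall>i<n. map_option b (((\<lambda>m. Option.bind m f) ^^ i) (Some s)) = Some True) \<and>
    ((\<lambda>m. Option.bind m f) ^^ n) (Some s) = Some r \<and> \<not> b r"
  using assms
proof (induction rule: while_sem.raw_induct[rotated, consumes 1, case_names step])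
  case (step w b f s r)
  show ?case
  proof (cases "b s")
    case True
    then obtain s' where s': "f s = Some s'" "w b f s' = Some r"
      using step(2) by (auto simp: bind_eq_Some_conv)
    then obtain n where n: "\<forall>i<n. map_option b (((\<lambda>m. Option.bind m f) ^^ i) (Some s')) = Some True"
        "((\<lambda>m. Option.bind m f) ^^ n) (Some s') = Some r" "\<not> b r"
      using step(1) by blast
    have "((\<lambda>m. Option.bind m f) ^^ Suc i) (Some s) = ((\<lambda>m. Option.bind m f) ^^ i) (Some s')" for i
      by (simp add: funpow_Suc_right s' del: funpow.simps)
    then show ?thesis
      using n True by (intro exI[of _ "Suc n"]) (auto simp: less_Suc_eq_0_disj simp del: funpow.simps(2))
  next
    case False
    then show ?thesis using step(2) by (intro exI[of _ 0]) auto
  qed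
qed

lemma while_sem_invariant:
  assumes "while_sem b f s = Some r" and "P s" and "\<And>s s'. P s \<Longrightarrow> f s = Some s' \<Longrightarrow> P s'"
  shows "P r"
proof -
  have "\<forall>r. ((\<lambda>m. Option.bind m f) ^^ n) (Some s) = Some r \<longrightarrow> P r" for n
    by (induction n) (use assms(2,3) in \<open>auto simp: bind_eq_Some_conv\<close>)
  then show ?thesis using while_sem_iterate[OF assms(1)] by blast
qed

lemma sem_unassigned: "sem eval test C s = Some s' \<Longrightarrow> w \<notin> asgn C \<Longrightarrow> s' w = s w"
proof (induction C arbitrary: s s')
  case (Seq C1 C2)
  obtain u where "sem eval test C1 s = Some u" "sem eval test C2 u = Some s'"
    using Seq.prems(1) by (auto simp: map_comp_Some_iff)
  then show ?case using Seq.IH Seq.prems(2) by (metis UnCI asgn.simps(3))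
next
  case (While E C)
  from While.prems(1) have sem: "while_sem (\<lambda>u. test (eval E u)) (sem eval test C) s = Some s'"
    by simp
  have step: "v w = s w" if "u w = s w" "sem eval test C u = Some v" for u v
    using While.IH[OF that(2)] While.prems(2) that(1) by simp
  show ?case
  proof (rule while_sem_invariant[where P = "\<lambda>u. u w = s w"])
    show "while_sem (\<lambda>u. test (eval E u)) (sem eval test C) s = Some s'" by (rule sem)
  qed (rule refl, erule (1) step)
next
  case (If E C1 C2)
  have "sem eval test C1 s = Some s' \<or> sem eval test C2 s = Some s'"
    using If.prems(1) by (auto split: if_splits)
  then show ?case using If.IH If.prems(2) by (metis UnCI asgn.simps(4))
qed auto

text \<open>\<open>k\<close> stands for the computation so far, from the initial store to the
  current one; leaving it arbitrary makes the induction pass through sequencing.\<close>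

definition env_determined :: "('v \<Rightarrow> 'v setobj) \<Rightarrow> (('v \<Rightarrow> 'val) \<Rightarrow> ('v \<Rightarrow> 'val) option) \<Rightarrow> bool"
  where "env_determined \<Gamma> k \<longleftrightarrow> (\<forall>v. determined (\<Gamma> v) (\<lambda>s. map_option (\<lambda>u. u v) (k s)))"

lemma env_determinedD:
  "env_determined \<Gamma> k \<Longrightarrow> determined (\<Gamma> v) (\<lambda>s. map_option (\<lambda>u. u v) (k s))"
  by (simp add: env_determined_def)

lemma determined_restrict:
  fixes \<Gamma> :: "'v::finite \<Rightarrow> 'v setobj"
  assumes "env_determined \<Gamma> k"
    and f: "\<And>u u'. (\<And>v. v \<in> A \<Longrightarrow> u v = u' v) \<Longrightarrow> f u = f u'"
  shows "determined (\<Prod>v\<in>A. \<Gamma> v) (\<lambda>s. map_option f (k s))"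
proof (rule determined_prod)
  show "determined (\<Gamma> v) (\<lambda>s. map_option (\<lambda>u. u v) (k s))" for v
    using assms(1) by (rule env_determinedD)
next
  fix s s' assume "clash (\<lambda>s. map_option f (k s)) s s'"
  then obtain u u' where u: "k s = Some u" "k s' = Some u'" "f u \<noteq> f u'"
    by (auto simp: clash_def)
  then obtain v where "v \<in> A" "u v \<noteq> u' v" using f by blast
  then show "\<exists>v\<in>A. clash (\<lambda>s. map_option (\<lambda>u. u v) (k s)) s s'"
    using u by (auto simp: clash_def)
qed simp

lemma determined_eval:
  fixes eval :: "'e \<Rightarrow> ('v::finite \<Rightarrow> 'val) \<Rightarrow> 'val" and \<Gamma> :: "'v \<Rightarrow> 'v setobj"
  assumes "expr_lang fv eval var"
    and "env_determined \<Gamma> k"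
  shows "determined (tE fv E \<Gamma>) (\<lambda>s. map_option (\<lambda>u. f (eval E u)) (k s))"
  unfolding tE_def
proof (rule determined_restrict[OF assms(2)])
  fix u u' :: "'v \<Rightarrow> 'val" assume "\<And>v. v \<in> fv E \<Longrightarrow> u v = u' v"
  then have "eval E u = eval E u'" by (rule expr_lang.eval_cong[OF assms(1)])
  then show "f (eval E u) = f (eval E u')" by simp
qed

text \<open>Induction on the command for every preceding computation \<open>k\<close>. Assigned
  variables go through \<open>determined_cond\<close> and \<open>determined_loop\<close>; unassigned
  ones keep their old dependency.\<close>

lemma env_determined_alg:
  fixes \<Gamma> :: "'v::finite \<Rightarrow> 'v setobj"
  assumes "expr_lang fv eval var"
    and "env_determined \<Gamma> k" and "1 \<le> p"
  shows "env_determined (alg fv C p \<Gamma>) (\<lambda>s. Option.bind (k s) (sem eval test C))"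
  using assms(2,3)
proof (induction C arbitrary: p \<Gamma> k)
  case Skip
  then show ?case by simp
next
  case (Assign x E)
  have "determined ((\<Gamma>(x := p * tE fv E \<Gamma>)) w)
    (\<lambda>s. map_option (\<lambda>u. u w) (Option.bind (k s) (sem eval test (Assign x E))))" for w
  proof (cases "w = x")
    case True
    have "tE fv E \<Gamma> \<le> p * tE fv E \<Gamma>"
      using qmult_mono[OF Assign.prems(2) order_refl, of "tE fv E \<Gamma>"] by simp
    with determined_eval[OF assms(1) Assign.prems(1), of E id]
    have "determined (p * tE fv E \<Gamma>) (\<lambda>s. map_option (\<lambda>u. id (eval E u)) (k s))"
      by (rule determined_weaken)
    then show ?thesis
      by (rule determined_weaken) (auto simp: True clash_def bind_eq_Some_conv)
  next
    case False
    then show ?thesis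
      by (auto intro!: determined_weaken[OF env_determinedD[OF Assign.prems(1), of w]]
          simp: clash_def bind_eq_Some_conv)
  qed
  then show ?case by (simp add: env_determined_def)
next
  case (Seq C1 C2)
  have "env_determined (alg fv C2 p (alg fv C1 p \<Gamma>))
      (\<lambda>s. Option.bind (Option.bind (k s) (sem eval test C1)) (sem eval test C2))"
    by (intro Seq)
  moreover have "Option.bind (Option.bind (k s) (sem eval test C1)) (sem eval test C2) =
      Option.bind (k s) (sem eval test (Seq C1 C2))" for s
    by (cases "k s") (auto simp: map_comp_def split: option.split bind_splits)
  ultimately show ?case by simp
next
  case (If E C1 C2)
  let ?t = "tE fv E \<Gamma>"
  let ?h = "\<lambda>w C s. map_option (\<lambda>u. u w) (Option.bind (k s) (sem eval test C))"
  note t = determined_eval[OF assms(1) If.prems(1), of E]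
  have pt: "1 \<le> p * ?t"
    using qmult_mono[OF If.prems(2) determined_one_le[OF t[of id]]] by simp
  have "determined (alg fv (If E C1 C2) p \<Gamma> w) (?h w (If E C1 C2))" for w
  proof (cases "w \<in> asgn C1 \<union> asgn C2")
    case True
    \<comment> \<open>Both branches are weakened to their join because
      \<open>determined_cond\<close> expects a common set object.\<close>
    have 1: "determined (sup (alg fv C1 (p * ?t) \<Gamma> w) (alg fv C2 (p * ?t) \<Gamma> w)) (?h w C1)"
      by (rule determined_weaken[OF env_determinedD[OF If.IH(1)[OF If.prems(1) pt]]]) simp_all
    have 2: "determined (sup (alg fv C1 (p * ?t) \<Gamma> w) (alg fv C2 (p * ?t) \<Gamma> w)) (?h w C2)"
      by (rule determined_weaken[OF env_determinedD[OF If.IH(2)[OF If.prems(1) pt]]]) simp_all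
    have "determined (?t * sup (alg fv C1 (p * ?t) \<Gamma> w) (alg fv C2 (p * ?t) \<Gamma> w)) (?h w (If E C1 C2))"
      by (rule determined_cond[OF t[of test] 1 2])
        (auto simp: bind_eq_Some_conv split: if_splits)
    then show ?thesis using True by (simp add: Let_def if_env_def)
  next
    case False
    \<comment> \<open>Two terminating runs that differ at an unassigned \<open>w\<close> already
      differed before, so the guard adds no dependency.\<close>
    have un: "z w = y w" if "sem eval test (If E C1 C2) y = Some z" for y z
      using sem_unassigned[OF that] False by simp
    have "determined (\<Gamma> w) (?h w (If E C1 C2))"
    proof (rule determined_weaken[OF env_determinedD[OF If.prems(1)] order_refl])
      fix s s' assume "clash (?h w (If E C1 C2)) s s'"
      then show "clash (\<lambda>s. map_option (\<lambda>u. u w) (k s)) s s'"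
        unfolding clash_def by (auto simp: bind_eq_Some_conv simp del: sem.simps dest!: un)
    qed
    then show ?thesis using False by (simp add: Let_def if_env_def)
  qed
  then show ?case unfolding env_determined_def by (rule allI)
next
  case (While E C)
  let ?F = "\<lambda>\<Theta>. sup \<Gamma> (alg fv C (p * tE fv E \<Theta>) \<Theta>)"
  let ?\<Theta> = "lfp ?F"
  let ?t = "tE fv E ?\<Theta>"
  let ?h = "\<lambda>w s. map_option (\<lambda>u. u w) (Option.bind (k s) (sem eval test (While E C)))"
  have unfold: "?\<Theta> = ?F ?\<Theta>" by (rule lfp_unfold[OF mono_alg_step])
  have \<Gamma>: "\<Gamma> v \<le> ?\<Theta> v" and step: "alg fv C (p * ?t) ?\<Theta> v \<le> ?\<Theta> v" for v
    by (subst unfold, simp)+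
  \<comment> \<open>The body is iterated without testing the guard; the guards are evaluated
    separately along the iterates.\<close>
  define K where "K i s = ((\<lambda>m. Option.bind m (sem eval test C)) ^^ i) (k s)" for i s
  have K0: "env_determined ?\<Theta> k"
    unfolding env_determined_def
    by (intro allI determined_weaken[OF env_determinedD[OF While.prems(1)] \<Gamma>])
  have pt: "1 \<le> p * ?t"
    using qmult_mono[OF While.prems(2) determined_one_le[OF determined_eval[OF assms(1) K0, of E id]]]
    by simp
  \<comment> \<open>The inequality \<open>step\<close> brings each iterate back to
    \<open>?\<Theta>\<close>, so one environment serves all iterations.\<close>
  have K: "env_determined ?\<Theta> (K i)" for i
  proof (induction i)
    case 0
    show ?case using K0 unfolding K_def by (simp only: funpow.simps id_apply)
  next
    case (Suc i)
    have "determined (?\<Theta> v) (\<lambda>s. map_option (\<lambda>u. u v) (Option.bind (K i s) (sem eval test C)))"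
      for v
      by (rule determined_weaken[OF env_determinedD[OF While.IH[OF Suc pt]] step])
    then show ?case
      unfolding K_def env_determined_def by (simp only: funpow.simps o_apply simp_thms)
  qed
  have "determined (alg fv (While E C) p \<Gamma> w) (?h w)" for w
  proof (cases "w \<in> asgn C")
    case True
    have "determined (qstar ?t * ?\<Theta> w) (?h w)"
    proof (rule determined_loop[OF determined_eval[OF assms(1) K, of E test] env_determinedD[OF K]])
      fix s b assume "?h w s = Some b"
      then obtain u r where u: "k s = Some u" "r w = b"
          "while_sem (\<lambda>u. test (eval E u)) (sem eval test C) u = Some r"
        by (auto simp: bind_eq_Some_conv)
      from while_sem_iterate[OF this(3)]
      show "\<exists>n. (\<forall>i<n. map_option (\<lambda>u. test (eval E u)) (K i s) = Some True) \<and>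
          map_option (\<lambda>u. test (eval E u)) (K n s) = Some False \<and>
          map_option (\<lambda>u. u w) (K n s) = Some b"
        unfolding K_def u(1) using u(2) by auto
    qed
    then show ?thesis using True by (simp add: Let_def while_env_def)
  next
    case False
    have un: "z w = y w" if "sem eval test (While E C) y = Some z" for y z
      using sem_unassigned[OF that] False by simp
    have "determined (?\<Theta> w) (?h w)"
    proof (rule determined_weaken[OF env_determinedD[OF K0] order_refl])
      fix s s' assume "clash (?h w) s s'"
      then show "clash (\<lambda>s. map_option (\<lambda>u. u w) (k s)) s s'"
        unfolding clash_def by (auto simp: bind_eq_Some_conv simp del: sem.simps dest!: un)
    qed
    then show ?thesis using False by (simp add: Let_def while_env_def)
  qed
  then show ?case unfolding env_determined_def by (rule allI)
qed

lemma determined_obs: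
  fixes eval :: "'e \<Rightarrow> ('v::finite \<Rightarrow> 'val) \<Rightarrow> 'val"
  assumes "expr_lang fv eval var"
  shows "determined (obs fv C W) (\<lambda>s. map_option (\<lambda>u. restrict u W) (sem eval test C s))"
proof -
  have "selector (gen v) (\<lambda>_. {v}) (\<lambda>s :: 'v \<Rightarrow> 'val. map_option (\<lambda>u. u v) (Some s))" for v :: 'v
    by (auto simp: selector_def gen.rep_eq clash_def)
  then have "env_determined gen (Some :: ('v \<Rightarrow> 'val) \<Rightarrow> _)"
    unfolding env_determined_def determined_def by (intro allI exI)
  from env_determined_alg[OF assms this order_refl]
  have "env_determined (Delta fv C) (sem eval test C)"
    by (simp add: Delta_def[abs_def])
  then show ?thesis
    unfolding obs_def by (rule determined_restrict) (auto simp: restrict_def)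
qed

section \<open>Pulling back along mediators\<close>

lemma Int_qoi_mult:
  "P \<in> qoi_rels \<P> \<Longrightarrow> Q \<in> qoi_rels \<Q> \<Longrightarrow> P \<inter> Q \<in> qoi_rels (\<P> * \<Q>)"
  unfolding times_qoi.rep_eq pairwise_join_def[symmetric]
  using qoi_rels[of \<P>] qoi_rels[of \<Q>]
  by (intro subsetD[OF tc_extensive[OF pairwise_join_LoI]]) (auto simp: pairwise_join_def)

lemma INT_qoi_prod:
  assumes "finite A" and "\<And>v. v \<in> A \<Longrightarrow> P v \<in> qoi_rels (\<sigma> v)"
  shows "(\<Inter>v\<in>A. P v) \<in> qoi_rels (\<Prod>v\<in>A. \<sigma> v)"
  using assms by (induction A) (auto simp: one_qoi.rep_eq intro: Int_qoi_mult)

text \<open>Joins in the quantale of information are closed under mixing, so the index set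
  \<open>X\<close> may vary from cell to cell.\<close>

lemma mix_in_alpha:
  assumes Q: "Q \<in> LoI"
    and cell: "\<And>d. \<exists>X\<in>setobj_sets \<X>. \<exists>P\<in>qoi_rels (\<Prod>v\<in>X. \<sigma> v). Q `` {d} = P `` {d}"
  shows "Q \<in> qoi_rels (alpha \<sigma> \<X>)"
proof -
  let ?A = "\<Union>X\<in>setobj_sets \<X>. qoi_rels (\<Prod>v\<in>X. \<sigma> v)"
  have A: "?A \<subseteq> LoI" using qoi_rels by blast
  have "Q \<in> mix ?A" using cell Q by (auto simp: mix_iff[OF A])
  then have "Q \<in> tc ?A" using Q by (auto simp: tc_def)
  then show ?thesis by (simp add: alpha_def Sup_qoi.rep_eq image_image)
qed

text \<open>A legal family extends to a total one that is constant on the cells of the chosen relations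
  \<open>P v\<close>. Choosing \<open>P_X\<close>, the intersection of the \<open>P v\<close> with \<open>v \<in> X\<close>, according to the selector at
  the extended store then yields an equivalence relation.\<close>

lemma factors_Id_pullback:
  fixes \<sigma> :: "'v::finite \<Rightarrow> 'd qoi"
  assumes "determined \<X> h" and "legal g \<sigma>"
  shows "factors_Id (h \<circ>\<^sub>m store_of g) (alpha \<sigma> \<X>)"
proof -
  obtain X where X: "X s \<in> setobj_sets \<X>"
      "\<forall>v\<in>X s. s v = s' v \<Longrightarrow> X s' = X s" "\<forall>v\<in>X s. s v = s' v \<Longrightarrow> \<not> clash h s s'" for s s'
    using assms(1) unfolding determined_def by (metis selectorD)
  obtain P where P: "P v \<in> qoi_rels (\<sigma> v)"
    and P_const: "(d, d') \<in> P v \<Longrightarrow> d \<in> dom (g v) \<Longrightarrow> d' \<in> dom (g v) \<Longrightarrow> g v d = g v d'" for v d d'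
    using assms(2) unfolding legal_def factors_Id_def by metis
  have PL: "P v \<in> LoI" for v using P qoi_rels by blast
  \<comment> \<open>The chosen value depends only on the cell of \<open>d\<close> in
    \<open>P v\<close>. On a cell where \<open>g v\<close> is nowhere defined it is arbitrary, but
    still constant.\<close>
  define G where "G d v = (SOME y. \<exists>d'\<in>P v `` {d}. g v d' = Some y)" for d v
  have G_cong: "G d' v = G d v" if "(d, d') \<in> P v" for d d' v
    unfolding G_def using LoI_image_eq[OF PL, of d' v d] that by auto
  have G_Some: "G d v = y" if "g v d = Some y" for d v y
  proof -
    have "\<exists>y. \<exists>d'\<in>P v `` {d}. g v d' = Some y"
      using that LoI_self[OF PL, of d v] by blast
    from someI_ex[OF this] obtain d' where "(d, d') \<in> P v" "g v d' = Some (G d v)"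
      unfolding G_def by blast
    then show ?thesis using P_const[of d d' v] that by auto
  qed
  define R where "R d = (\<Inter>v\<in>X (G d). P v)" for d
  have R_mem: "R d \<in> qoi_rels (\<Prod>v\<in>X (G d). \<sigma> v)" for d
    unfolding R_def by (intro INT_qoi_prod P) simp
  then have RL: "R d \<in> LoI" for d using qoi_rels by blast
  define Q where "Q = {(d, d'). (d, d') \<in> R d}"
  have agree: "\<forall>v\<in>X (G d). G d v = G d' v" if "(d, d') \<in> Q" for d d'
    using that G_cong by (auto simp: Q_def R_def)
  \<comment> \<open>\<open>Q\<close> uses the relation chosen at its first argument. Related points
    choose the same relation, which gives symmetry and transitivity of \<open>Q\<close>.\<close>
  then have R_cong: "R d' = R d" if "(d, d') \<in> Q" for d d'
    unfolding R_def using X(2)[OF agree[OF that]] by simp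
  have eqR: "equiv UNIV (R d)" for d using RL by (simp add: LoI_def)
  have "equiv UNIV Q"
  proof (rule equivI)
    show "refl Q"
      using LoI_self[OF RL] by (auto simp: Q_def refl_on_def)
    show "sym Q"
    proof (rule symI)
      fix d d' assume Q: "(d, d') \<in> Q"
      then have "(d', d) \<in> R d" using equivE[OF eqR[of d]] by (auto simp: Q_def dest: symD)
      then show "(d', d) \<in> Q" by (simp add: Q_def R_cong[OF Q])
    qed
    show "trans Q"
    proof (rule transI)
      fix d d' d'' assume Q: "(d, d') \<in> Q" "(d', d'') \<in> Q"
      then have "(d, d') \<in> R d" "(d', d'') \<in> R d"
        using R_cong[OF Q(1)] by (simp_all add: Q_def)
      then show "(d, d'') \<in> Q"
        using equivE[OF eqR[of d]] by (auto simp: Q_def dest: transD)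
    qed
  qed simp
  then have "Q \<in> LoI" by (simp add: LoI_def)
  moreover have "Q `` {d} = R d `` {d}" for d by (auto simp: Q_def)
  ultimately have Q: "Q \<in> qoi_rels (alpha \<sigma> \<X>)"
    using R_mem X(1) by (intro mix_in_alpha) blast+
  have pull: "(h \<circ>\<^sub>m store_of g) d = h (G d)" if d: "d \<in> dom (h \<circ>\<^sub>m store_of g)" for d
  proof -
    obtain s where s: "store_of g d = Some s" using d by (auto simp: map_comp_Some_iff)
    have "s v = G d v" for v
    proof -
      have "d \<in> dom (g v)" and "s v = the (g v d)"
        using s by (auto simp: store_of_def split: if_splits)
      then have "g v d = Some (s v)" by (simp add: domIff)
      then show ?thesis by (rule G_Some[symmetric])
    qed
    then have "s = G d" by (rule ext)
    with s show ?thesis by (simp add: map_comp_def)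
  qed
  have "(h \<circ>\<^sub>m store_of g) d = (h \<circ>\<^sub>m store_of g) d'"
    if Q: "(d, d') \<in> Q" and dom: "d \<in> dom (h \<circ>\<^sub>m store_of g)" "d' \<in> dom (h \<circ>\<^sub>m store_of g)" for d d'
  proof -
    have "h (G d) \<noteq> None" "h (G d') \<noteq> None"
      using dom unfolding domIff pull[OF dom(1)] pull[OF dom(2)] .
    then have "h (G d) = h (G d')"
      using X(3)[OF agree[OF Q]] unfolding clash_def by fastforce
    then show ?thesis by (simp only: pull[OF dom(1)] pull[OF dom(2)])
  qed
  with Q show ?thesis unfolding factors_Id_def by blast
qed

theorem theorem9:
  fixes fv :: "'e \<Rightarrow> 'v::finite set"
    and eval :: "'e \<Rightarrow> ('v \<Rightarrow> 'val) \<Rightarrow> 'val"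
    and var :: "'v \<Rightarrow> 'e"
    and test :: "'val \<Rightarrow> bool"
    and \<sigma> :: "'v \<Rightarrow> ('d::finite) qoi"
  assumes "expr_lang fv eval var"
    and "range \<sigma> \<subseteq> M1"
  shows "(\<forall>C W g. mediator_family g \<longrightarrow> legal g \<sigma> \<longrightarrow>
            factors_Id (map_option (\<lambda>s. restrict s W) \<circ> (sem eval test C \<circ>\<^sub>m store_of g))
              (alpha \<sigma> (obs fv C W)))
       \<and> (\<forall>C \<Gamma>'. typed fv 1 \<sigma> C \<Gamma>' \<longrightarrow>
            (\<forall>W. alpha \<sigma> (obs fv C W) \<le> (\<Prod>w\<in>W. \<Gamma>' w)))
       \<and> ((\<forall>C W. alpha \<sigma> (obs fv C W) = (\<Prod>w\<in>W. alg fv C 1 \<sigma> w))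
            \<longleftrightarrow> (\<forall>v. \<sigma> v * \<sigma> v = \<sigma> v))"
proof (intro conjI allI impI)
  have \<sigma>: "1 \<le> \<sigma> v" for v using assms(2) by (auto simp: M1_def)
  show "factors_Id (map_option (\<lambda>s. restrict s W) \<circ> (sem eval test C \<circ>\<^sub>m store_of g))
      (alpha \<sigma> (obs fv C W))" if "legal g \<sigma>" for C W g
  proof -
    have "map_option (\<lambda>s. restrict s W) \<circ> (sem eval test C \<circ>\<^sub>m store_of g) =
        (\<lambda>s. map_option (\<lambda>s. restrict s W) (sem eval test C s)) \<circ>\<^sub>m store_of g"
      by (auto simp: fun_eq_iff map_comp_def split: option.split)
    then show ?thesis using factors_Id_pullback[OF determined_obs[OF assms(1)] that] by metis
  qed
  show "alpha \<sigma> (obs fv C W) \<le> (\<Prod>w\<in>W. \<Gamma>' w)" if "typed fv 1 \<sigma> C \<Gamma>'" for C \<Gamma>' W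
    by (rule order_trans[OF alpha_obs_le qprod_mono])
      (use alg_le_typed[OF that] \<sigma> in \<open>simp_all add: le_fun_def\<close>)
  show "(\<forall>C W. alpha \<sigma> (obs fv C W) = (\<Prod>w\<in>W. alg fv C 1 \<sigma> w))
      \<longleftrightarrow> (\<forall>v. \<sigma> v * \<sigma> v = \<sigma> v)"
  proof (intro iffI allI)
    show "\<sigma> v * \<sigma> v = \<sigma> v"
      if "\<forall>C W. alpha \<sigma> (obs fv C W) = (\<Prod>w\<in>W. alg fv C 1 \<sigma> w)" for v
      \<comment> \<open>The expression \<open>var v\<close> serves as a guard whose only free
        variable is \<open>v\<close>.\<close>
      by (rule idempotent_if_agree[where fv = fv and E = "var v"])
        (simp_all add: \<sigma> that expr_lang.fv_var[OF assms(1)])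
    show "alpha \<sigma> (obs fv C W) = (\<Prod>w\<in>W. alg fv C 1 \<sigma> w)"
      if "\<forall>v. \<sigma> v * \<sigma> v = \<sigma> v" for C W
      by (intro antisym alpha_obs_le alpha_obs_ge) (simp_all add: \<sigma> that)
  qed
qed

end
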